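(* Let $\mathcal T_n$ be a random binary search tree with $n$ nodes. Define functions $q_\ell,r_\ell:[0,\infty)\to\mathbb R$, $\ell\ge1$, recursively by $q_1(t)=e^{-2t}$ and, for $\ell\ge2$, $$r_{\ell-1}(t)=e^{-t}\int_0^t q_{\ell-1}(s)e^{s}\,\mathrm ds,\qquad q_\ell(t)=q_1(t)+2r_{\ell-1}(t)-r_{\ell-1}(t)^2,$$ and set $$p_{*,\ell}=1-\int_0^\infty q_\ell(t)e^{-t}\,\mathrm dt .$$ For each fixed integer $\ell\ge1$, let $p_{\mathsf p,\ell}(\mathcal T_n)$ be the proportion of nodes of $\mathcal T_n$ that are $\ell$-protected. Then, as $n\to\infty$: (i) the probability $\mathbb E\,p_{\mathsf p,\ell}(\mathcal T_n)$ that a uniformly random node in the random tree $\mathcal T_n$ is $\ell$-protected tends to $p_{*,\ell}$; (ii) $p_{\mathsf p,\ell}(\mathcal T_n)$ converges in probability to $p_{*,\ell}$. In particular, for $\ell=2$ (protected nodes) the limit is $p_{*,2}=11/30$.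
   Context: A random binary search tree with $n$ nodes is the binary tree with $n$ nodes obtained by inserting, in the standard manner, $n$ independent uniform $[0,1]$ random variables $X_1,\dots,X_n$ successively into an initially empty tree (each node holds one key; smaller keys go to the left subtree and larger keys to the right subtree). A leaf is a node with no children. For an integer $\ell\ge1$, a node is $\ell$-protected if it has distance at least $\ell$ to every leaf that is a descendant of it (a node counts as a descendant of itself, at distance $0$); 2-protected nodes are called protected: they are the non-leaf nodes none of whose children is a leaf. *)

theory Defs
  imports "HOL-Probability.Probability"
begin

(* In 'a tree the constructor Leaf is the empty tree; the leaves of the
   mathematical text are the nodes accepted by is_leaf below. *)

(* Equal keys go to the right; for independent uniform keys ties have probability 0. *)
fun bst_insert :: "real \<Rightarrow> real tree \<Rightarrow> real tree" where
  "bst_insert x Leaf = Node Leaf x Leaf"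
| "bst_insert x (Node l a r) =
     (if x < a then Node (bst_insert x l) a r else Node l a (bst_insert x r))"

definition bst_of :: "real list \<Rightarrow> real tree" where
  "bst_of xs = fold bst_insert xs Leaf"

(* A node is given by its address, the path leading to it from the root:
   False is a step to the left child, True a step to the right child. *)
fun nodes :: "'a tree \<Rightarrow> bool list set" where
  "nodes Leaf = {}"
| "nodes (Node l a r) = insert [] ((#) False ` nodes l \<union> (#) True ` nodes r)"

definition is_leaf :: "'a tree \<Rightarrow> bool list \<Rightarrow> bool" where
  "is_leaf t v \<longleftrightarrow> v \<in> nodes t \<and> v @ [False] \<notin> nodes t \<and> v @ [True] \<notin> nodes t"

(* The descendants of v are the nodes v @ u, at distance length u from v. *)
definition is_protected :: "nat \<Rightarrow> 'a tree \<Rightarrow> bool list \<Rightarrow> bool" where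
  "is_protected l t v \<longleftrightarrow> v \<in> nodes t \<and> (\<forall>u. is_leaf t (v @ u) \<longrightarrow> l \<le> length u)"

definition protected_proportion :: "nat \<Rightarrow> 'a tree \<Rightarrow> real" where
  "protected_proportion l t = real (card {v. is_protected l t v}) / real (card (nodes t))"

(* The joint experiment: draw w from M, then draw a node of T w uniformly at random. *)
definition random_node_protected_prob :: "'w measure \<Rightarrow> ('w \<Rightarrow> 'a tree) \<Rightarrow> nat \<Rightarrow> real" where
  "random_node_protected_prob M T l =
     measure (M \<bind> (\<lambda>w. measure_pmf (map_pmf (is_protected l (T w)) (pmf_of_set (nodes (T w)))))) {True}"

definition iid_uniform :: "'w measure \<Rightarrow> nat \<Rightarrow> (nat \<Rightarrow> 'w \<Rightarrow> real) \<Rightarrow> bool" where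
  "iid_uniform M n X \<longleftrightarrow>
     prob_space M \<and> prob_space.indep_vars M (\<lambda>_. borel) X {..<n} \<and>
     (\<forall>i<n. distr M borel (X i) = uniform_measure lborel {0..1})"

definition random_bst :: "nat \<Rightarrow> (nat \<Rightarrow> 'w \<Rightarrow> real) \<Rightarrow> 'w \<Rightarrow> real tree" where
  "random_bst n X w = bst_of (map (\<lambda>i. X i w) [0..<n])"

definition tendsto_in_prob ::
  "(nat \<Rightarrow> 'w measure) \<Rightarrow> (nat \<Rightarrow> 'w \<Rightarrow> real) \<Rightarrow> real \<Rightarrow> bool" where
  "tendsto_in_prob M Y c \<longleftrightarrow>
     (\<forall>\<epsilon>>0. (\<lambda>n. measure (M n) {w \<in> space (M n). \<bar>Y n w - c\<bar> > \<epsilon>}) \<longlonglongrightarrow> 0)"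

(* Only indices l \<ge> 1 and arguments t \<ge> 0 are meaningful; q_fun 0 is a dummy. *)
function q_fun :: "nat \<Rightarrow> real \<Rightarrow> real" and r_fun :: "nat \<Rightarrow> real \<Rightarrow> real" where
  "q_fun 0 t = 0"
| "q_fun (Suc 0) t = exp (- 2 * t)"
| "q_fun (Suc (Suc l)) t = q_fun (Suc 0) t + 2 * r_fun (Suc l) t - (r_fun (Suc l) t)\<^sup>2"
| "r_fun l t = exp (- t) * integral {0..t} (\<lambda>s. q_fun l s * exp s)"
  by pat_completeness auto
termination
  by (relation "Wellfounded.measure (case_sum (\<lambda>(l, _). 2 * l) (\<lambda>(l, _). 2 * l + 1))") auto

definition p_star :: "nat \<Rightarrow> real" where
  "p_star l = 1 - integral {0..} (\<lambda>t. q_fun l t * exp (- t))"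

end

theory Submission
  imports Defs
begin

text \<open>
  The shape of \<open>\<T>\<^sub>n\<close> satisfies the quicksort recursion: the left subtree size is uniform on
  \<open>{0..n-1}\<close> and, given the sizes, the two subtrees are independent copies. Indeed the keys are
  exchangeable and almost surely distinct, so conditionally on the set of keys their order is a
  uniformly random permutation. The number of non-protected nodes is additive over subtrees, with
  toll the indicator of the event that the root has a leaf at distance less than \<open>\<ell>\<close>. If \<open>a\<^sub>k\<close> is the
  probability of this event for \<open>k\<close> nodes, solving the recursion gives the mean as
  \<open>c (n + 1) + O(1)\<close> with \<open>c = \<Sum>\<^sub>k 2 a\<^sub>k / ((k+1)(k+2))\<close>; the second moment about \<open>c (n + 1)\<close> obeys
  the same recursion with a toll of order \<open>n\<close>, hence is \<open>O(n log n)\<close>, and Chebyshev applies. Finally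
  the substitution \<open>x = 1 - e\<^sup>-\<^sup>t\<close> turns the differential equation for \<open>\<Sum>\<^sub>k a\<^sub>k x\<^sup>k\<close> into the recursion for
  \<open>q\<^sub>\<ell>\<close> and \<open>r\<^sub>\<ell>\<close>, and \<open>c\<close> into the integral of \<open>q\<^sub>\<ell>(t) e\<^sup>-\<^sup>t\<close>.
\<close>


section \<open>Protected nodes and shallow trees\<close>

text \<open>The failure of \<open>l\<close>-protection at the root: some leaf lies at depth below
  \<open>l\<close>. The recursive form lets its probability over random shapes be computed from the
  two subtrees. The empty tree has no leaf, so it is never shallow.\<close>

fun shallow :: "nat \<Rightarrow> 'a tree \<Rightarrow> bool" where
  "shallow l Leaf = False"
| "shallow 0 (Node L a R) = False"
| "shallow (Suc l) (Node L a R) = (L = Leaf \<and> R = Leaf \<or> shallow l L \<or> shallow l R)"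

fun num_unprotected :: "nat \<Rightarrow> 'a tree \<Rightarrow> nat" where
  "num_unprotected l Leaf = 0"
| "num_unprotected l (Node L a R) =
     of_bool (shallow l (Node L a R)) + num_unprotected l L + num_unprotected l R"

lemma Nil_in_nodes [simp]: "[] \<in> nodes t \<longleftrightarrow> t \<noteq> Leaf"
  by (cases t) auto

lemma finite_nodes [simp]: "finite (nodes t)"
  by (induction t) auto

lemma nodes_empty_iff [simp]: "nodes t = {} \<longleftrightarrow> t = Leaf"
  by (cases t) auto

lemma nodes_map_tree [simp]: "nodes (map_tree f t) = nodes t"
  by (induction t) auto

lemma is_leaf_Leaf [simp]: "\<not> is_leaf Leaf v"
  by (simp add: is_leaf_def)

lemma is_leaf_Node_Nil [simp]: "is_leaf (Node L a R) [] \<longleftrightarrow> L = Leaf \<and> R = Leaf"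
  by (auto simp: is_leaf_def)

lemma is_leaf_Node_Cons [simp]: "is_leaf (Node L a R) (b # v) \<longleftrightarrow> is_leaf (if b then R else L) v"
  by (auto simp: is_leaf_def)

lemma is_protected_map_tree [simp]: "is_protected l (map_tree f t) v = is_protected l t v"
  by (simp add: is_protected_def is_leaf_def)

lemma protected_proportion_map_tree [simp]:
  "protected_proportion l (map_tree f t) = protected_proportion l t"
  by (simp add: protected_proportion_def)

text \<open>A path to a leaf is either empty, when the root itself is a leaf, or starts with a step
  into a subtree, which uses up one unit of depth.\<close>

lemma shallow_iff: "shallow l t \<longleftrightarrow> (\<exists>u. is_leaf t u \<and> length u < l)"
proof (induction l t rule: shallow.induct)
  case (3 l L a R)
  have "(\<exists>u. is_leaf (Node L a R) u \<and> length u < Suc l) \<longleftrightarrow>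
     is_leaf (Node L a R) [] \<or> (\<exists>b v. is_leaf (Node L a R) (b # v) \<and> length v < l)"
    (is "_ = ?rhs")
    by (metis (no_types, opaque_lifting) length_Cons list.exhaust list.size(3) not_less_eq zero_less_Suc)
  also have "?rhs \<longleftrightarrow> L = Leaf \<and> R = Leaf \<or> shallow l L \<or> shallow l R"
    unfolding "3.IH" by (auto simp: ex_bool_eq)
  finally show ?case by simp
qed auto

lemma card_nodes: "card (nodes t) = size t"
proof (induction t)
  case (Node L a R)
  have "card (nodes (Node L a R)) = Suc (card ((#) False ` nodes L \<union> (#) True ` nodes R))"
    by (subst nodes.simps, subst card_insert_disjoint) auto
  also have "\<dots> = Suc (card (nodes L) + card (nodes R))"
    by (subst card_Un_disjoint) (auto simp: card_image)
  finally show ?case using Node by simp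
qed simp

lemma finite_protected [simp]: "finite {v. is_protected l t v}"
  by (rule finite_subset[of _ "nodes t"]) (auto simp: is_protected_def)

lemma is_protected_Nil: "is_protected l t [] \<longleftrightarrow> t \<noteq> Leaf \<and> \<not> shallow l t"
  by (auto simp: is_protected_def shallow_iff not_less)

lemma is_protected_Node_Cons:
  "is_protected l (Node L a R) (b # v) \<longleftrightarrow> is_protected l (if b then R else L) v"
  by (auto simp: is_protected_def)

text \<open>Protection of a node depends only on the subtree below it, so forming a
  \<open>Node\<close> adds just the root, which \<open>shallow\<close> assigns to one of the two
  counts. The additive form avoids truncated subtraction.\<close>

lemma card_protected: "card {v. is_protected l t v} + num_unprotected l t = size t"
proof (induction t)
  case (Node L a R)
  let ?t = "Node L a R"
  let ?B = "(#) False ` {v. is_protected l L v} \<union> (#) True ` {v. is_protected l R v}"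
  have "v \<in> {v. is_protected l ?t v} \<longleftrightarrow> v \<in> (if shallow l ?t then {} else {[]}) \<union> ?B" for v
    by (cases v) (auto simp: is_protected_Nil is_protected_Node_Cons)
  then have eq: "{v. is_protected l ?t v} = (if shallow l ?t then {} else {[]}) \<union> ?B"
    by blast
  have B: "card ?B = card {v. is_protected l L v} + card {v. is_protected l R v}"
    by (subst card_Un_disjoint) (auto simp: card_image)
  have "card {v. is_protected l ?t v} = of_bool (\<not> shallow l ?t) + card ?B"
    unfolding eq by (subst card_Un_disjoint) auto
  with B Node show ?case by simp
qed (simp add: is_protected_def)

lemma protected_proportion_eq:
  assumes "t \<noteq> Leaf"
  shows "protected_proportion l t = 1 - num_unprotected l t / size t"
proof -
  have "real (size t) = card {v. is_protected l t v} + num_unprotected l t"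
    using card_protected[of l t] by linarith
  moreover have "size t > 0" using assms by (cases t) auto
  ultimately show ?thesis by (simp add: protected_proportion_def card_nodes field_simps)
qed

lemma num_unprotected_le: "num_unprotected l t \<le> size t"
  using card_protected[of l t] by linarith

section \<open>The law of the shape\<close>

text \<open>The splitting law of the random binary search tree, taken here as a definition;
  \<open>distr_keys_shape\<close> shows that trees built from uniform keys follow it. With
  \<open>unit\<close> labels each of these laws has finite support.\<close>

function bst_shape :: "nat \<Rightarrow> unit tree pmf" where
  "bst_shape 0 = return_pmf Leaf"
| "bst_shape (Suc n) = do {
     k \<leftarrow> pmf_of_set {..n};
     L \<leftarrow> bst_shape k;
     R \<leftarrow> bst_shape (n - k);
     return_pmf (Node L () R)}"
  by pat_completeness auto
termination
  by (relation "Wellfounded.measure id") (auto simp: set_pmf_of_set)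

declare bst_shape.simps(2) [simp del]

lemma size_bst_shape: "t \<in> set_pmf (bst_shape n) \<Longrightarrow> size t = n"
proof (induction n arbitrary: t rule: less_induct)
  case (less n)
  show ?case
  proof (cases n)
    case 0
    with less show ?thesis by simp
  next
    case (Suc m)
    from less.prems obtain k L R where "k \<le> m" "L \<in> set_pmf (bst_shape k)"
      "R \<in> set_pmf (bst_shape (m - k))" and t: "t = Node L () R"
      by (auto simp: Suc bst_shape.simps(2) set_pmf_of_set)
    with less.IH[of k L] less.IH[of "m - k" R] show ?thesis by (simp add: Suc)
  qed
qed

lemma finite_set_bst_shape [simp]: "finite (set_pmf (bst_shape n))"
  by (induction n rule: bst_shape.induct) (auto simp: bst_shape.simps(2) set_pmf_of_set)

section \<open>Expectations under the shape law\<close>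

abbreviation expect :: "nat \<Rightarrow> (unit tree \<Rightarrow> real) \<Rightarrow> real" where
  "expect n \<equiv> measure_pmf.expectation (bst_shape n)"

lemma integrable_bst_shape [simp]: "integrable (measure_pmf (bst_shape n)) (f :: _ \<Rightarrow> real)"
  by (rule integrable_measure_pmf_finite) simp

text \<open>Finite support turns the binds into finite sums. The iterated expectation expresses the
  independence of the two subtrees given their sizes.\<close>

lemma expect_Suc:
  "expect (Suc n) f =
     (\<Sum>k\<le>n. expect k (\<lambda>L. expect (n - k) (\<lambda>R. f (Node L () R)))) / real (Suc n)"
proof -
  have 1: "measure_pmf.expectation (bst_shape k \<bind> (\<lambda>L. bst_shape j \<bind> (\<lambda>R. return_pmf (Node L () R)))) f
     = expect k (\<lambda>L. expect j (\<lambda>R. f (Node L () R)))" for k j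
  proof -
    have "measure_pmf.expectation (bst_shape k \<bind> (\<lambda>L. bst_shape j \<bind> (\<lambda>R. return_pmf (Node L () R)))) f
      = (\<Sum>L\<in>set_pmf (bst_shape k). pmf (bst_shape k) L *\<^sub>R
           measure_pmf.expectation (bst_shape j \<bind> (\<lambda>R. return_pmf (Node L () R))) f)"
      by (rule pmf_expectation_bind) auto
    also have "\<dots> = expect k (\<lambda>L. expect j (\<lambda>R. f (Node L () R)))"
      by (subst integral_measure_pmf[of "set_pmf (bst_shape k)"])
        (auto simp: map_pmf_def[symmetric])
    finally show ?thesis .
  qed
  show ?thesis
    unfolding bst_shape.simps(2)
    by (subst pmf_expectation_bind_pmf_of_set) (auto simp: 1 sum_divide_distrib divide_inverse mult.commute sum_distrib_left)
qed

lemma expect_cong: "(\<And>t. size t = n \<Longrightarrow> f t = g t) \<Longrightarrow> expect n f = expect n g"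
  by (rule integral_cong_AE) (auto simp: AE_measure_pmf_iff size_bst_shape)

lemma expect_mono: "(\<And>t. size t = n \<Longrightarrow> f t \<le> g t) \<Longrightarrow> expect n f \<le> expect n g"
  by (rule integral_mono_AE) (auto simp: AE_measure_pmf_iff size_bst_shape)

definition shallow_prob :: "nat \<Rightarrow> nat \<Rightarrow> real" where
  "shallow_prob l n = expect n (\<lambda>t. of_bool (shallow l t))"

lemma shallow_prob_bounds: "0 \<le> shallow_prob l n" "shallow_prob l n \<le> 1"
proof -
  show "0 \<le> shallow_prob l n" unfolding shallow_prob_def by (rule integral_nonneg_AE) auto
  have "shallow_prob l n \<le> expect n (\<lambda>_. 1)"
    unfolding shallow_prob_def by (rule expect_mono) auto
  then show "shallow_prob l n \<le> 1" by simp
qed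

lemma shallow_prob_0 [simp]: "shallow_prob l 0 = 0" "shallow_prob 0 n = 0"
proof -
  have "shallow 0 (t :: unit tree) = False" for t by (cases t) auto
  then show "shallow_prob 0 n = 0" by (simp add: shallow_prob_def)
qed (simp add: shallow_prob_def)

text \<open>Inclusion-exclusion for two independent subtrees, one of which must be shallow at level
  \<open>l\<close>. The separate summand is the tree with a single node, whose root is a
  leaf.\<close>

lemma shallow_prob_Suc:
  "shallow_prob (Suc l) (Suc n) = of_bool (n = 0) +
     (\<Sum>k\<le>n. shallow_prob l k + shallow_prob l (n - k) - shallow_prob l k * shallow_prob l (n - k))
       / real (Suc n)"
proof -
  have *: "expect k (\<lambda>L. expect (n - k) (\<lambda>R. of_bool (shallow (Suc l) (Node L () R)))) =
     of_bool (n = 0) +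
       (shallow_prob l k + shallow_prob l (n - k) - shallow_prob l k * shallow_prob l (n - k))"
    if "k \<le> n" for k
  proof -
    \<comment> \<open>For \<open>n = 0\<close> both subtrees are empty and not shallow, so the first
      summand never overlaps with the others.\<close>
    have "of_bool (shallow (Suc l) (Node L () R)) =
        (of_bool (n = 0) + of_bool (shallow l L)) + (1 - of_bool (shallow l L)) * (of_bool (shallow l R) :: real)"
      if "size L = k" "size R = n - k" for L R
    proof (cases "n = 0")
      case False
      with that \<open>k \<le> n\<close> have "\<not> (L = Leaf \<and> R = Leaf)" by auto
      with False show ?thesis by auto
    qed (use that \<open>k \<le> n\<close> in auto)
    then have "expect k (\<lambda>L. expect (n - k) (\<lambda>R. of_bool (shallow (Suc l) (Node L () R)))) =
      expect k (\<lambda>L. expect (n - k) (\<lambda>R. (of_bool (n = 0) + of_bool (shallow l L)) +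
          (1 - of_bool (shallow l L)) * (of_bool (shallow l R) :: real)))"
      by (intro expect_cong) simp
    also have "\<dots> = expect k (\<lambda>L. of_bool (n = 0) + of_bool (shallow l L) +
          (1 - of_bool (shallow l L)) * shallow_prob l (n - k))"
      by (simp add: shallow_prob_def)
    also have "\<dots> = of_bool (n = 0) + shallow_prob l k + (1 - shallow_prob l k) * shallow_prob l (n - k)"
      by (simp add: shallow_prob_def)
    finally show ?thesis by (simp add: algebra_simps)
  qed
  have "shallow_prob (Suc l) (Suc n) =
      (\<Sum>k\<le>n. expect k (\<lambda>L. expect (n - k) (\<lambda>R. of_bool (shallow (Suc l) (Node L () R))))) / real (Suc n)"
    unfolding shallow_prob_def by (rule expect_Suc)
  also have "\<dots> = (\<Sum>k\<le>n. of_bool (n = 0) + (shallow_prob l k + shallow_prob l (n - k)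
        - shallow_prob l k * shallow_prob l (n - k))) / real (Suc n)"
    by (intro arg_cong2[of _ _ _ _ "(/)"] sum.cong refl *) simp
  also have "\<dots> = of_bool (n = 0) + (\<Sum>k\<le>n. shallow_prob l k + shallow_prob l (n - k)
        - shallow_prob l k * shallow_prob l (n - k)) / real (Suc n)"
    by (subst sum.distrib) (simp add: add_divide_distrib)
  finally show ?thesis .
qed

section \<open>The quicksort recurrence\<close>

text \<open>
  Iterating the quicksort recurrence with toll \<open>t\<close>: the closed form is found by differencing
  the sequence \<open>x n / (n + 1)\<close>.
\<close>

lemma quicksort_recurrence_le:
  fixes x t :: "nat \<Rightarrow> real"
  assumes "x 0 \<le> t 0"
    and rec: "\<And>n. x (Suc n) \<le> t (Suc n) + 2 / (real n + 1) * (\<Sum>k\<le>n. x k)"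
  shows "x n \<le> t n + (real n + 1) * (\<Sum>k<n. 2 * t k / ((real k + 1) * (real k + 2)))"
proof -
  define G where "G n = (\<Sum>k<n. 2 * t k / ((real k + 1) * (real k + 2)))" for n
  define y where "y n = t n + (real n + 1) * G n" for n
  \<comment> \<open>\<open>y\<close> solves the recurrence with equality; this closed form of its
    partial sums is what verifies it.\<close>
  have sum_y: "(\<Sum>k\<le>n. y k) = (real n + 1) * (real n + 2) / 2 * G (Suc n)" for n
  proof (induction n)
    case 0
    show ?case by (simp add: y_def G_def)
  next
    case (Suc n)
    have [simp]: "real n + 2 \<noteq> 0" "real n + 3 \<noteq> 0" by linarith+
    have "G (Suc (Suc n)) = G (Suc n) + 2 * t (Suc n) / ((real n + 2) * (real n + 3))"
      by (simp add: G_def add_ac)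
    then have "(real n + 2) * (real n + 3) / 2 * G (Suc (Suc n))
      = (real n + 2) * (real n + 3) / 2 * G (Suc n) + t (Suc n)"
      by (simp del: distrib_left distrib_right distrib_left_numeral distrib_right_numeral add: distrib_left[of _ "G (Suc n)"])
    moreover have "real (Suc n) + 1 = real n + 2" "real (Suc n) + 2 = real n + 3" by simp_all
    moreover have "(real n + 1) * (real n + 2) / 2 * g + (u + (real n + 2) * g) =
        (real n + 2) * (real n + 3) / 2 * g + u" for g u
      by (simp add: algebra_simps add_divide_distrib)
    ultimately show ?case using Suc by (simp only: sum.atMost_Suc y_def)
  qed
  have "x n \<le> y n"
  proof (induction n rule: less_induct)
    case (less n)
    show ?case
    proof (cases n)
      case 0
      with assms(1) show ?thesis by (simp add: y_def G_def)
    next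
      case (Suc m)
      have "x n \<le> t n + 2 / (real m + 1) * (\<Sum>k\<le>m. x k)" using rec Suc by simp
      also have "\<dots> \<le> t n + 2 / (real m + 1) * (\<Sum>k\<le>m. y k)"
        using less Suc by (intro add_left_mono mult_left_mono sum_mono) auto
      also have "\<dots> = y n"
      proof -
        have "real m + 1 \<noteq> 0" by linarith
        then have "2 / (real m + 1) * ((real m + 1) * (real m + 2) / 2 * g) = (real m + 2) * g" for g
          by simp
        then show ?thesis unfolding sum_y Suc y_def[of "Suc m"] by (simp add: add_ac)
      qed
      finally show ?thesis .
    qed
  qed
  then show ?thesis by (simp add: y_def G_def)
qed

lemma sum_atMost_rev: fixes f :: "nat \<Rightarrow> real" shows "(\<Sum>k\<le>n. f (n - k)) = (\<Sum>k\<le>n. f k)"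
  using sum.nat_diff_reindex[of f "Suc n"] by (simp add: lessThan_Suc_atMost)

section \<open>The mean number of unprotected nodes\<close>

definition mean_unprotected :: "nat \<Rightarrow> nat \<Rightarrow> real" where
  "mean_unprotected l n = expect n (\<lambda>t. num_unprotected l t)"

text \<open>The root contributes the toll. Since \<open>k\<close> and \<open>n - k\<close> run
  through the same values, both subtrees contribute the same sum, hence the factor 2.\<close>

lemma mean_unprotected_Suc:
  "mean_unprotected l (Suc n) = shallow_prob l (Suc n) + 2 / (real n + 1) * (\<Sum>k\<le>n. mean_unprotected l k)"
proof -
  have "mean_unprotected l (Suc n) =
    (\<Sum>k\<le>n. expect k (\<lambda>L. expect (n - k) (\<lambda>R. of_bool (shallow l (Node L () R)) +
        (real (num_unprotected l L) + real (num_unprotected l R))))) / real (Suc n)"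
    unfolding mean_unprotected_def expect_Suc by (simp add: add_ac)
  also have "\<dots> = shallow_prob l (Suc n) +
     (\<Sum>k\<le>n. mean_unprotected l k + mean_unprotected l (n - k)) / real (Suc n)"
    by (simp add: shallow_prob_def expect_Suc mean_unprotected_def sum.distrib add_divide_distrib)
  also have "\<dots> = shallow_prob l (Suc n) + 2 / (real n + 1) * (\<Sum>k\<le>n. mean_unprotected l k)"
    by (simp add: sum.distrib sum_atMost_rev add_ac)
  finally show ?thesis .
qed

text \<open>The constant \<open>c\<close> of the overview: the sum in the quicksort solution for the
  toll \<open>shallow_prob l\<close>, extended to infinity.\<close>

definition unprotected_density :: "nat \<Rightarrow> real" where
  "unprotected_density l = (\<Sum>k. 2 * shallow_prob l k / ((real k + 1) * (real k + 2)))"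

text \<open>Telescoping by partial fractions. The shift by \<open>n\<close> provides the tail that
  controls truncation of \<open>unprotected_density\<close>.\<close>

lemma inverse_product_sums: "(\<lambda>k. 2 / ((real (k + n) + 1) * (real (k + n) + 2))) sums (2 / (real n + 1))"
proof -
  have "(\<lambda>k. 2 / (real (k + n) + 1)) \<longlonglongrightarrow> 0" by real_asymp
  from telescope_sums'[OF this]
  have "(\<lambda>k. 2 / (real (k + n) + 1) - 2 / (real (Suc k + n) + 1)) sums (2 / (real n + 1))"
    by simp
  also have "(\<lambda>k. 2 / (real (k + n) + 1) - 2 / (real (Suc k + n) + 1)) =
      (\<lambda>k. 2 / ((real (k + n) + 1) * (real (k + n) + 2)))"
  proof
    fix k
    have *: "2 / (x + 1) - 2 / (x + 2) = 2 / ((x + 1) * (x + 2))" if "x \<ge> 0" for x :: real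
      using that by (simp add: field_simps)
    show "2 / (real (k + n) + 1) - 2 / (real (Suc k + n) + 1) =
        2 / ((real (k + n) + 1) * (real (k + n) + 2))"
      using *[of "real (k + n)"] by (simp add: add_ac)
  qed
  finally show ?thesis .
qed

lemma density_term_bounds:
  "0 \<le> 2 * shallow_prob l k / ((real k + 1) * (real k + 2))"
  "2 * shallow_prob l k / ((real k + 1) * (real k + 2)) \<le> 2 / ((real k + 1) * (real k + 2))"
  using shallow_prob_bounds[of l k] by (auto intro!: divide_right_mono)

lemma density_summable: "summable (\<lambda>k. 2 * shallow_prob l k / ((real k + 1) * (real k + 2)))"
proof (rule summable_comparison_test')
  show "summable (\<lambda>k. 2 / ((real k + 1) * (real k + 2)))"
    using inverse_product_sums[of 0] by (simp add: sums_iff)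
  show "norm (2 * shallow_prob l k / ((real k + 1) * (real k + 2))) \<le> 2 / ((real k + 1) * (real k + 2))" for k
    using density_term_bounds[of l k] by (simp only: real_norm_def abs_of_nonneg)
qed

lemma density_tail:
  "(\<Sum>k<n. 2 * shallow_prob l k / ((real k + 1) * (real k + 2))) \<le> unprotected_density l"
  "unprotected_density l \<le>
     (\<Sum>k<n. 2 * shallow_prob l k / ((real k + 1) * (real k + 2))) + 2 / (real n + 1)"
proof -
  let ?f = "\<lambda>k. 2 * shallow_prob l k / ((real k + 1) * (real k + 2))"
  have split: "unprotected_density l = (\<Sum>k. ?f (k + n)) + (\<Sum>k<n. ?f k)"
    unfolding unprotected_density_def by (rule suminf_split_initial_segment[OF density_summable])
  have s: "summable (\<lambda>k. ?f (k + n))"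
    using density_summable[of l] by (rule summable_ignore_initial_segment)
  have "(\<Sum>k. ?f (k + n)) \<le> (\<Sum>k. 2 / ((real (k + n) + 1) * (real (k + n) + 2)))"
    by (rule suminf_le[OF density_term_bounds(2) s sums_summable[OF inverse_product_sums]])
  also have "\<dots> = 2 / (real n + 1)" using inverse_product_sums[of n] by (simp add: sums_iff)
  finally show "unprotected_density l \<le> (\<Sum>k<n. ?f k) + 2 / (real n + 1)" using split by linarith
  have "0 \<le> (\<Sum>k. ?f (k + n))" by (rule suminf_nonneg[OF s]) (rule density_term_bounds)
  then show "(\<Sum>k<n. ?f k) \<le> unprotected_density l" using split by linarith
qed

lemma unprotected_density_bounds: "0 \<le> unprotected_density l" "unprotected_density l \<le> 2"
  using density_tail[of 0 l] density_tail[of l 0] by auto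

text \<open>The recurrence is solved exactly, with a toll between 0 and 1 as the only boundary term.
  Replacing the truncated series by its limit costs at most
  \<open>(n + 1) * (2 / (n + 1)) = 2\<close>.\<close>

lemma mean_unprotected_approx:
  "\<bar>mean_unprotected l n - unprotected_density l * (real n + 1)\<bar> \<le> 2"
proof -
  let ?G = "\<Sum>k<n. 2 * shallow_prob l k / ((real k + 1) * (real k + 2))"
  have up: "mean_unprotected l n \<le> shallow_prob l n + (real n + 1) * ?G"
    by (rule quicksort_recurrence_le) (auto simp: mean_unprotected_Suc, simp add: mean_unprotected_def)
  \<comment> \<open>The same comparison for the negated sequence and toll yields the reverse
    inequality.\<close>
  have "- mean_unprotected l n \<le> - shallow_prob l n +
      (real n + 1) * (\<Sum>k<n. 2 * (- shallow_prob l k) / ((real k + 1) * (real k + 2)))"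
    by (rule quicksort_recurrence_le)
      (auto simp: mean_unprotected_Suc sum_negf, simp add: mean_unprotected_def)
  then have lo: "mean_unprotected l n \<ge> shallow_prob l n + (real n + 1) * ?G"
    by (simp add: sum_negf)
  have "(real n + 1) * ?G \<le> (real n + 1) * unprotected_density l"
    using density_tail by (intro mult_left_mono) auto
  moreover have "(real n + 1) * unprotected_density l \<le> (real n + 1) * (?G + 2 / (real n + 1))"
    using density_tail by (intro mult_left_mono) auto
  moreover have "(real n + 1) * (?G + 2 / (real n + 1)) = (real n + 1) * ?G + 2"
  proof -
    have "real n + 1 \<noteq> 0" by linarith
    then have "(real n + 1) * (2 / (real n + 1)) = 2" by (simp del: distrib_right_numeral distrib_left_numeral)
    then show ?thesis by (simp only: distrib_left)
  qed
  ultimately show ?thesis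
    using up lo shallow_prob_bounds[of l n] unfolding mult.commute[of "unprotected_density l"] abs_le_iff by linarith
qed

section \<open>Concentration\<close>

text \<open>Centring at \<open>c * (n + 1)\<close> instead of the mean makes deviations additive
  over subtrees: the centres for sizes \<open>k\<close> and \<open>n - k\<close> add up to exactly
  the centre for size \<open>Suc n\<close>.\<close>

definition spread :: "nat \<Rightarrow> nat \<Rightarrow> real" where
  "spread l n = expect n (\<lambda>t. (num_unprotected l t - unprotected_density l * (real n + 1))\<^sup>2)"

lemma deviation_bound:
  assumes "size t = n"
  shows "\<bar>num_unprotected l t - unprotected_density l * (real n + 1)\<bar> \<le> 2 * (real n + 1)"
proof -
  have "unprotected_density l * (real n + 1) \<le> 2 * (real n + 1)"
    using unprotected_density_bounds by (intro mult_right_mono) auto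
  moreover have "0 \<le> unprotected_density l * (real n + 1)"
    using unprotected_density_bounds by simp
  moreover have "real (num_unprotected l t) \<le> real n" using num_unprotected_le[of l t] assms by simp
  ultimately show ?thesis unfolding abs_le_iff distrib_left by linarith
qed

text \<open>With toll \<open>b\<close> the deviation is \<open>b + (x + y)\<close>, and
  \<open>b * b = b\<close>. The crude bounds on \<open>x\<close> and \<open>y\<close> add up to
  \<open>2 * n + 4\<close>, so the terms involving \<open>b\<close> are at most
  \<open>1 + 2 * (2 * n + 4) = 4 * n + 9\<close>.\<close>

lemma deviation_Node:
  fixes c :: real and l :: nat
  assumes "k \<le> n" "size L = k" "size R = n - k"
  defines "c \<equiv> unprotected_density l"
  defines "x \<equiv> num_unprotected l L - c * (real k + 1)"
    and "y \<equiv> num_unprotected l R - c * (real (n - k) + 1)"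
  shows "(num_unprotected l (Node L a R) - c * (real (Suc n) + 1))\<^sup>2 \<le>
    x\<^sup>2 + y\<^sup>2 + 2 * x * y + (4 * real n + 9)"
proof -
  define b :: real where "b = of_bool (shallow l (Node L a R))"
  have "num_unprotected l (Node L a R) - c * (real (Suc n) + 1) = b + (x + y)"
    using assms(1) by (simp add: x_def y_def b_def of_nat_diff algebra_simps)
  moreover have "(b + (x + y))\<^sup>2 = (x\<^sup>2 + y\<^sup>2 + 2 * x * y) + b * (1 + 2 * (x + y))"
  proof -
    have "b * b = b" by (simp add: b_def)
    then show ?thesis by (simp add: power2_eq_square algebra_simps)
  qed
  moreover have "b * (1 + 2 * (x + y)) \<le> 4 * real n + 9"
  proof -
    have "\<bar>x\<bar> \<le> 2 * (real k + 1)" "\<bar>y\<bar> \<le> 2 * (real (n - k) + 1)"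
      unfolding x_def y_def c_def by (rule deviation_bound; use assms in simp)+
    then have "1 + 2 * (x + y) \<le> 4 * real n + 9" using assms(1) by (simp add: of_nat_diff)
    then show ?thesis by (simp add: b_def)
  qed
  ultimately show ?thesis by simp
qed

lemma spread_Suc:
  "spread l (Suc n) \<le> 17 * (real (Suc n) + 1) + 2 / (real n + 1) * (\<Sum>k\<le>n. spread l k)"
proof -
  define c where "c = unprotected_density l"
  define d where "d k t = num_unprotected l t - c * (real k + 1)" for k and t :: "unit tree"
  have m: "expect k (d k) = mean_unprotected l k - c * (real k + 1)" for k
    by (simp add: d_def[abs_def] mean_unprotected_def)
  have bound: "expect k (\<lambda>L. expect (n - k) (\<lambda>R. (num_unprotected l (Node L () R) - c * (real (Suc n) + 1))\<^sup>2))
      \<le> spread l k + spread l (n - k) + (4 * real n + 17)" if "k \<le> n" for k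
  proof -
    have "expect k (\<lambda>L. expect (n - k) (\<lambda>R. (num_unprotected l (Node L () R) - c * (real (Suc n) + 1))\<^sup>2))
      \<le> expect k (\<lambda>L. expect (n - k) (\<lambda>R. (d k L)\<^sup>2 + (d (n - k) R)\<^sup>2 + 2 * d k L * d (n - k) R + (4 * real n + 9)))"
      unfolding d_def c_def using that by (intro expect_mono deviation_Node)
    also have "\<dots> = expect k (\<lambda>L. (d k L)\<^sup>2 + spread l (n - k) + 2 * d k L * expect (n - k) (d (n - k)) + (4 * real n + 9))"
      by (simp add: spread_def d_def[abs_def] c_def)
    also have "\<dots> = spread l k + spread l (n - k) + 2 * (expect k (d k) * expect (n - k) (d (n - k))) + (4 * real n + 9)"
      by (simp add: spread_def d_def[abs_def] c_def)
    \<comment> \<open>Independence has turned the cross term into a product of means, each at most 2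
      in absolute value; it adds 8 to the 9 already present.\<close>
    also have "expect k (d k) * expect (n - k) (d (n - k)) \<le> \<bar>expect k (d k)\<bar> * \<bar>expect (n - k) (d (n - k))\<bar>"
      by (simp flip: abs_mult)
    also have "\<dots> \<le> 2 * 2"
      unfolding m c_def by (intro mult_mono mean_unprotected_approx) auto
    finally show ?thesis by simp
  qed
  have "spread l (Suc n) = (\<Sum>k\<le>n. expect k (\<lambda>L. expect (n - k) (\<lambda>R.
      (num_unprotected l (Node L () R) - c * (real (Suc n) + 1))\<^sup>2))) / real (Suc n)"
    unfolding spread_def c_def by (rule expect_Suc)
  also have "\<dots> \<le> (\<Sum>k\<le>n. spread l k + spread l (n - k) + (4 * real n + 17)) / real (Suc n)"
    by (intro divide_right_mono sum_mono bound) auto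
  also have "\<dots> = (4 * real n + 17) + 2 / (real n + 1) * (\<Sum>k\<le>n. spread l k)"
  proof -
    have "real n + 1 \<noteq> 0" by linarith
    then show ?thesis by (simp add: sum.distrib sum_atMost_rev[of "spread l"] add_divide_distrib add_ac)
  qed
  \<comment> \<open>This weaker bound makes the toll proportional to size plus one, which cancels a
    factor of the denominator in the quicksort solution.\<close>
  also have "4 * real n + 17 \<le> 17 * (real (Suc n) + 1)" by simp
  finally show ?thesis by simp
qed

text \<open>A linear toll leaves a harmonic sum in the quicksort solution, which is the source of
  the order \<open>n log n\<close>.\<close>

lemma spread_le: "spread l n \<le> (real n + 1) * (17 + 34 * (\<Sum>k<n. 1 / (real k + 2)))"
proof -
  have "spread l n \<le> 17 * (real n + 1) +
      (real n + 1) * (\<Sum>k<n. 2 * (17 * (real k + 1)) / ((real k + 1) * (real k + 2)))"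
  proof (rule quicksort_recurrence_le[OF _ spread_Suc])
    have "(unprotected_density l)\<^sup>2 \<le> 2\<^sup>2"
      using unprotected_density_bounds by (intro power_mono)
    then show "spread l 0 \<le> 17 * (real 0 + 1)" by (simp add: spread_def)
  qed
  also have "(\<Sum>k<n. 2 * (17 * (real k + 1)) / ((real k + 1) * (real k + 2))) = 34 * (\<Sum>k<n. 1 / (real k + 2))"
    unfolding sum_distrib_left
  proof (rule sum.cong)
    fix k
    have *: "real k + 1 \<noteq> 0" "real k + 2 \<noteq> 0" by linarith+
    show "2 * (17 * (real k + 1)) / ((real k + 1) * (real k + 2)) = 34 * (1 / (real k + 2))"
      using * by (simp add: divide_eq_eq eq_divide_eq)
  qed simp
  finally show ?thesis by (simp add: distrib_left mult_ac)
qed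

lemma spread_tendsto_0: "(\<lambda>n. spread l n / (real n)\<^sup>2) \<longlonglongrightarrow> 0"
proof (rule tendsto_sandwich[where f = "\<lambda>_. 0"])
  have sum_le: "(\<Sum>k<n. 1 / (real k + 2)) \<le> ln (real n + 1)" for n
  proof (induction n)
    case (Suc n)
    \<comment> \<open>The harmonic sum is compared with the logarithm one increment at a
      time.\<close>
    have "ln ((real n + 1) / (real n + 2)) \<le> (real n + 1) / (real n + 2) - 1"
      by (rule ln_le_minus_one) auto
    also have "\<dots> = - (1 / (real n + 2))" by (simp add: field_simps)
    finally have "1 / (real n + 2) \<le> ln (real n + 2) - ln (real n + 1)"
      by (simp add: ln_div)
    with Suc show ?case by (simp add: add_ac)
  qed simp
  show "\<forall>\<^sub>F n in sequentially. spread l n / (real n)\<^sup>2 \<le>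
      (real n + 1) * (17 + 34 * ln (real n + 1)) / (real n)\<^sup>2"
  proof (rule always_eventually, rule allI, rule divide_right_mono)
    fix n
    have "(real n + 1) * (17 + 34 * (\<Sum>k<n. 1 / (real k + 2))) \<le> (real n + 1) * (17 + 34 * ln (real n + 1))"
      using sum_le[of n] by (intro mult_left_mono) auto
    with spread_le[of l n] show "spread l n \<le> (real n + 1) * (17 + 34 * ln (real n + 1))" by linarith
  qed simp
  show "(\<lambda>n. (real n + 1) * (17 + 34 * ln (real n + 1)) / (real n)\<^sup>2) \<longlonglongrightarrow> 0"
    by real_asymp
  show "\<forall>\<^sub>F n in sequentially. 0 \<le> spread l n / (real n)\<^sup>2"
    by (auto simp: spread_def intro!: always_eventually integral_nonneg_AE)
qed simp

section \<open>Limit of the mean and Chebyshev bound\<close>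

lemma expect_protected_proportion:
  assumes "n > 0"
  shows "expect n (protected_proportion l) = 1 - mean_unprotected l n / real n"
proof -
  have "expect n (protected_proportion l) = expect n (\<lambda>t. 1 - num_unprotected l t / real n)"
    using assms by (intro expect_cong, subst protected_proportion_eq) auto
  then show ?thesis by (simp add: mean_unprotected_def)
qed

lemma expect_protected_proportion_tendsto:
  "(\<lambda>n. expect n (protected_proportion l)) \<longlonglongrightarrow> 1 - unprotected_density l"
proof -
  have "(\<lambda>n. expect n (protected_proportion l) - (1 - unprotected_density l)) \<longlonglongrightarrow> 0"
  proof (rule Lim_null_comparison)
    show "(\<lambda>n. 4 / real n) \<longlonglongrightarrow> 0" by real_asymp
    show "eventually (\<lambda>n. norm (expect n (protected_proportion l) - (1 - unprotected_density l)) \<le> 4 / real n) sequentially"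
      using eventually_gt_at_top[of 0]
    proof eventually_elim
      case (elim n)
      have "expect n (protected_proportion l) - (1 - unprotected_density l) =
         (- unprotected_density l - (mean_unprotected l n - unprotected_density l * (real n + 1))) / real n"
        using elim by (simp add: expect_protected_proportion field_simps)
      moreover have "\<bar>- unprotected_density l - (mean_unprotected l n - unprotected_density l * (real n + 1))\<bar> \<le> 4"
        using mean_unprotected_approx[of l n] unprotected_density_bounds[of l] by linarith
      ultimately show ?case by (simp add: divide_right_mono)
    qed
  qed
  then show ?thesis by (rule LIM_zero_cancel)
qed

text \<open>Chebyshev's inequality, via a pointwise bound on the indicator. As \<open>spread\<close>
  is centred at \<open>c * (n + 1)\<close> and not at \<open>c * n\<close>, an extra
  \<open>c\<close> enters; \<open>(d + c)^2 <= 2 * d^2 + 2 * c^2\<close> with \<open>c <= 2\<close>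
  produces the constant 8.\<close>

lemma prob_deviation_tendsto_0:
  assumes "\<epsilon> > 0"
  shows "(\<lambda>n. measure_pmf.prob (bst_shape n)
            {t. \<bar>protected_proportion l t - (1 - unprotected_density l)\<bar> > \<epsilon>}) \<longlonglongrightarrow> 0"
proof (rule Lim_null_comparison)
  let ?c = "unprotected_density l"
  show "\<forall>\<^sub>F n in sequentially. norm (measure_pmf.prob (bst_shape n)
            {t. \<bar>protected_proportion l t - (1 - ?c)\<bar> > \<epsilon>})
          \<le> 2 / \<epsilon>\<^sup>2 * (spread l n / (real n)\<^sup>2) + 8 / (\<epsilon> * real n)\<^sup>2"
    using eventually_gt_at_top[of 0]
  proof eventually_elim
    case (elim n)
    let ?E = "{t. \<bar>protected_proportion l t - (1 - ?c)\<bar> > \<epsilon>}"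
    let ?d = "\<lambda>t. num_unprotected l t - ?c * (real n + 1)"
    have "measure_pmf.prob (bst_shape n) ?E = expect n (indicator ?E)" by simp
    also have "\<dots> \<le> expect n (\<lambda>t. 2 / (\<epsilon> * real n)\<^sup>2 * (?d t)\<^sup>2 + 8 / (\<epsilon> * real n)\<^sup>2)"
    proof (rule expect_mono)
      fix t :: "unit tree" assume t: "size t = n"
      show "indicator ?E t \<le> 2 / (\<epsilon> * real n)\<^sup>2 * (?d t)\<^sup>2 + 8 / (\<epsilon> * real n)\<^sup>2"
      proof (cases "t \<in> ?E")
        case True
        have "t \<noteq> Leaf" using t elim by auto
        then have "protected_proportion l t - (1 - ?c) = - (?d t + ?c) / real n"
          using t elim by (simp add: protected_proportion_eq field_simps)
        moreover have "\<epsilon> < \<bar>protected_proportion l t - (1 - ?c)\<bar>" using True by simp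
        ultimately have "\<epsilon> < \<bar>?d t + ?c\<bar> / real n" by (simp only: abs_divide abs_minus_cancel abs_of_nat)
        then have "\<epsilon> * real n < \<bar>?d t + ?c\<bar>" using elim by (simp add: field_simps)
        then have "(\<epsilon> * real n)\<^sup>2 \<le> (?d t + ?c)\<^sup>2"
          using assms elim by (simp add: abs_le_square_iff[symmetric] abs_mult)
        also have "\<dots> \<le> 2 * (?d t)\<^sup>2 + 2 * ?c\<^sup>2"
          using zero_le_power2[of "?d t - ?c"] by (simp add: power2_eq_square algebra_simps)
        also have "?c\<^sup>2 \<le> 2\<^sup>2" using unprotected_density_bounds by (intro power_mono)
        finally have le: "(\<epsilon> * real n)\<^sup>2 \<le> 2 * (?d t)\<^sup>2 + 8" by simp
        have "0 < (\<epsilon> * real n)\<^sup>2" using assms elim by simp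
        with le have "1 \<le> (2 * (?d t)\<^sup>2 + 8) / (\<epsilon> * real n)\<^sup>2" by (simp only: le_divide_eq_1_pos)
        then show ?thesis using True by (simp add: add_divide_distrib)
      qed simp
    qed
    also have "\<dots> = 2 / \<epsilon>\<^sup>2 * (spread l n / (real n)\<^sup>2) + 8 / (\<epsilon> * real n)\<^sup>2"
      by (simp add: spread_def power_mult_distrib)
    finally show ?case by simp
  qed
  have "(\<lambda>n. 2 / \<epsilon>\<^sup>2 * (spread l n / (real n)\<^sup>2)) \<longlonglongrightarrow> 0"
    by (rule tendsto_mult_right_zero[OF spread_tendsto_0])
  moreover have "(\<lambda>n. 8 / (\<epsilon> * real n)\<^sup>2) \<longlonglongrightarrow> 0"
    using assms by real_asymp
  ultimately show "(\<lambda>n. 2 / \<epsilon>\<^sup>2 * (spread l n / (real n)\<^sup>2) + 8 / (\<epsilon> * real n)\<^sup>2) \<longlonglongrightarrow> 0"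
    using tendsto_add by fastforce
qed

section \<open>Identification of the limit\<close>

definition shallow_gf :: "nat \<Rightarrow> real \<Rightarrow> real" where
  "shallow_gf l x = (\<Sum>n. shallow_prob l n * x ^ n)"

lemma shallow_prob_abs_le: "\<bar>shallow_prob l n\<bar> \<le> 1"
  using shallow_prob_bounds[of l n] by auto

lemma summable_norm_shallow_gf:
  assumes "\<bar>x\<bar> < 1"
  shows "summable (\<lambda>n. norm (shallow_prob l n * x ^ n))"
proof (rule summable_comparison_test')
  show "summable (\<lambda>n. \<bar>x\<bar> ^ n)" using assms by (simp add: summable_geometric)
  show "norm (norm (shallow_prob l n * x ^ n)) \<le> \<bar>x\<bar> ^ n" for n
    using mult_right_mono[OF shallow_prob_abs_le[of l n], of "\<bar>x\<bar> ^ n"]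
    by (simp add: abs_mult power_abs)
qed

lemma summable_shallow_gf: "\<bar>x\<bar> < 1 \<Longrightarrow> summable (\<lambda>n. shallow_prob l n * x ^ n)"
  by (rule summable_norm_cancel[OF summable_norm_shallow_gf])

lemma shallow_gf_0 [simp]: "shallow_gf l 0 = 0" "shallow_gf 0 x = 0"
  by (simp_all add: shallow_gf_def powser_zero)

lemma has_derivative_shallow_gf:
  assumes "\<bar>x\<bar> < 1"
  shows "(shallow_gf l has_field_derivative (\<Sum>n. diffs (shallow_prob l) n * x ^ n)) (at x)"
  unfolding shallow_gf_def[abs_def]
  by (rule termdiffs_strong'[where K = 1]) (use assms summable_shallow_gf in auto)

text \<open>Multiplication by \<open>n + 1\<close> clears the denominator of the splitting
  recursion, and the reflected sum equals the original one.\<close>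

lemma diffs_shallow_prob_Suc:
  "diffs (shallow_prob (Suc l)) n = of_bool (n = 0) + 2 * (\<Sum>k\<le>n. shallow_prob l k) -
     (\<Sum>k\<le>n. shallow_prob l k * shallow_prob l (n - k))"
proof -
  have "real (Suc n) * (of_bool (n = 0) + s / real (Suc n)) = of_bool (n = 0) + s" for s
    by (auto simp: distrib_left simp del: of_nat_Suc)
  then have "diffs (shallow_prob (Suc l)) n = of_bool (n = 0) +
     (\<Sum>k\<le>n. shallow_prob l k + shallow_prob l (n - k) - shallow_prob l k * shallow_prob l (n - k))"
    unfolding diffs_def shallow_prob_Suc by simp
  then show ?thesis by (simp add: sum.distrib sum_subtractf sum_atMost_rev)
qed

text \<open>The differential equation \<open>A_(l+1)' = 1 + 2 * A_l / (1 - x) - A_l^2\<close>. The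
  partial sums of coefficients form a Cauchy product with the geometric series, the convolution is a
  Cauchy square.\<close>

lemma diffs_shallow_gf_sums:
  assumes "\<bar>x\<bar> < 1"
  shows "(\<lambda>n. diffs (shallow_prob (Suc l)) n * x ^ n) sums
           (1 + 2 * shallow_gf l x / (1 - x) - (shallow_gf l x)\<^sup>2)"
proof -
  let ?a = "\<lambda>n. shallow_prob l n * x ^ n"
  have geo: "summable (\<lambda>n. norm (x ^ n))" "(\<Sum>n. x ^ n) = 1 / (1 - x)"
    using assms by (simp_all add: summable_geometric suminf_geometric norm_power power_abs)
  have 1: "(\<lambda>n. \<Sum>k\<le>n. ?a k * x ^ (n - k)) sums (shallow_gf l x * (1 / (1 - x)))"
    using Cauchy_product_sums[OF summable_norm_shallow_gf[OF assms, of l] geo(1)]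
    by (simp add: geo(2) shallow_gf_def)
  have 2: "(\<lambda>n. \<Sum>k\<le>n. ?a k * ?a (n - k)) sums (shallow_gf l x * shallow_gf l x)"
    using Cauchy_product_sums[OF summable_norm_shallow_gf[OF assms, of l] summable_norm_shallow_gf[OF assms, of l]]
    by (simp add: shallow_gf_def)
  have 3: "(\<lambda>n. if n = 0 then 1 else 0 :: real) sums 1"
    using sums_single[of 0 "\<lambda>_. 1 :: real"] by (simp cong: if_cong)
  have "(\<lambda>n. (if n = 0 then 1 else 0) + 2 * (\<Sum>k\<le>n. ?a k * x ^ (n - k)) - (\<Sum>k\<le>n. ?a k * ?a (n - k))) sums
     (1 + 2 * (shallow_gf l x * (1 / (1 - x))) - shallow_gf l x * shallow_gf l x)"
    by (intro sums_diff sums_add sums_mult 1 2 3)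
  moreover have "(if n = 0 then 1 else 0) + 2 * (\<Sum>k\<le>n. ?a k * x ^ (n - k)) - (\<Sum>k\<le>n. ?a k * ?a (n - k)) =
     diffs (shallow_prob (Suc l)) n * x ^ n" for n
  proof -
    have "(\<Sum>k\<le>n. ?a k * x ^ (n - k)) = (\<Sum>k\<le>n. shallow_prob l k) * x ^ n"
      unfolding sum_distrib_right by (intro sum.cong refl) (simp flip: power_add)
    moreover have "(\<Sum>k\<le>n. ?a k * ?a (n - k)) = (\<Sum>k\<le>n. shallow_prob l k * shallow_prob l (n - k)) * x ^ n"
      unfolding sum_distrib_right by (intro sum.cong refl) (simp add: mult_ac flip: power_add)
    ultimately show ?thesis by (simp add: diffs_shallow_prob_Suc algebra_simps)
  qed
  ultimately show ?thesis by (simp add: power2_eq_square)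
qed

declare q_fun.simps [simp del] r_fun.simps [simp del]

text \<open>
  In the Yule process a subtree still to be born at time \<open>0\<close> has \<open>n\<close> nodes at time \<open>t\<close> with
  probability \<open>e\<^sup>-\<^sup>t x\<^sup>n\<close>, where \<open>x = 1 - e\<^sup>-\<^sup>t\<close>; under this substitution \<open>r_fun\<close> and \<open>q_fun\<close> become
  the generating function of \<open>shallow_prob\<close> and its derivative.
\<close>

lemma q_fun_Suc_eq:
  assumes "t \<ge> 0" "r_fun l t = exp (- t) * shallow_gf l (1 - exp (- t)) \<or> l = 0"
  shows "q_fun (Suc l) t = exp (- 2 * t) * (\<Sum>n. diffs (shallow_prob (Suc l)) n * (1 - exp (- t)) ^ n)"
proof -
  let ?A = "shallow_gf l (1 - exp (- t))"
  have sq: "exp (- 2 * t) = (exp (- t))\<^sup>2" by (simp flip: exp_double)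
  have "(\<Sum>n. diffs (shallow_prob (Suc l)) n * (1 - exp (- t)) ^ n) =
      1 + 2 * ?A / (1 - (1 - exp (- t))) - ?A\<^sup>2"
    by (rule sums_unique[OF diffs_shallow_gf_sums, symmetric]) (use assms(1) in auto)
  then have "exp (- 2 * t) * (\<Sum>n. diffs (shallow_prob (Suc l)) n * (1 - exp (- t)) ^ n) =
      exp (- 2 * t) + 2 * (exp (- t) * ?A) - (exp (- t) * ?A)\<^sup>2"
  proof -
    have "y\<^sup>2 * (1 + 2 * A / (1 - (1 - y)) - A\<^sup>2) = y\<^sup>2 + 2 * (y * A) - (y * A)\<^sup>2" if "y \<noteq> 0" for y A :: real
      using that by (simp add: field_simps power2_eq_square)
    then show ?thesis using \<open>_ = 1 + _ - _\<close> unfolding sq by simp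
  qed
  \<comment> \<open>For \<open>l = 0\<close> the generating function vanishes and only
    \<open>exp (- 2 * t)\<close>, the base case, remains.\<close>
  also have "\<dots> = q_fun (Suc l) t"
    using assms(2) by (cases l) (auto simp: q_fun.simps)
  finally show ?thesis ..
qed

text \<open>By the chain rule the integrand \<open>q_fun l s * exp s\<close> is the derivative of
  \<open>shallow_gf l (1 - exp (- s))\<close>, which vanishes at \<open>s = 0\<close>.\<close>

lemma r_fun_eq:
  assumes "t \<ge> 0"
    and q: "\<And>s. s \<ge> 0 \<Longrightarrow> q_fun l s = exp (- 2 * s) * (\<Sum>n. diffs (shallow_prob l) n * (1 - exp (- s)) ^ n)"
  shows "r_fun l t = exp (- t) * shallow_gf l (1 - exp (- t))"
proof -
  have "((\<lambda>s. q_fun l s * exp s) has_integral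
      shallow_gf l (1 - exp (- t)) - shallow_gf l (1 - exp (- 0))) {0..t}"
  proof (rule fundamental_theorem_of_calculus[OF assms(1)])
    fix s assume "s \<in> {0..t}"
    then have s: "s \<ge> 0" by simp
    have "((\<lambda>s. shallow_gf l (1 - exp (- s))) has_field_derivative
        (\<Sum>n. diffs (shallow_prob l) n * (1 - exp (- s)) ^ n) * exp (- s)) (at s)"
      by (rule DERIV_chain2[OF has_derivative_shallow_gf]) (use s in \<open>auto intro!: derivative_eq_intros\<close>)
    moreover have "(\<Sum>n. diffs (shallow_prob l) n * (1 - exp (- s)) ^ n) * exp (- s) = q_fun l s * exp s"
    proof -
      have "exp (- 2 * s) * exp s = exp (- s)" by (simp flip: exp_add)
      then show ?thesis unfolding q[OF s] by (simp add: mult_ac)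
    qed
    ultimately show "((\<lambda>s. shallow_gf l (1 - exp (- s))) has_vector_derivative q_fun l s * exp s) (at s within {0..t})"
      by (simp add: has_real_derivative_iff_has_vector_derivative has_vector_derivative_at_within)
  qed
  then show ?thesis by (simp add: r_fun.simps integral_unique)
qed

text \<open>The two preceding lemmas alternate: the formula for \<open>q_fun\<close> at one level
  gives \<open>r_fun\<close> there, which gives \<open>q_fun\<close> at the next.\<close>

lemma q_fun_eq_gf:
  "t \<ge> 0 \<Longrightarrow> q_fun (Suc l) t = exp (- 2 * t) * (\<Sum>n. diffs (shallow_prob (Suc l)) n * (1 - exp (- t)) ^ n)"
proof (induction l arbitrary: t)
  case 0
  then show ?case by (intro q_fun_Suc_eq) auto
next
  case (Suc l)
  from Suc.prems show ?case
    by (rule q_fun_Suc_eq) (use r_fun_eq[OF Suc.prems Suc.IH] in auto)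
qed

text \<open>A Beta integral: with \<open>x = 1 - exp (- t)\<close> it becomes the integral of
  \<open>(n + 1) * a * x^n * (1 - x)^2\<close> over the unit interval.\<close>

lemma nn_integral_density_term:
  fixes a :: real
  assumes "a \<ge> 0"
  shows "(\<integral>\<^sup>+t. ennreal (real (Suc n) * a * (1 - exp (- t)) ^ n * exp (- 3 * t)) * indicator {0..} t \<partial>lborel) =
     ennreal (2 * a / ((real (Suc n) + 1) * (real (Suc n) + 2)))"
proof -
  define m where "m = real (Suc n)"
  have m: "m + 1 \<noteq> 0" "m + 2 \<noteq> 0" by (auto simp: m_def)
  \<comment> \<open>The antiderivative of \<open>a * m * x^n * (1 - x)^2\<close>, found by expanding
    the square.\<close>
  define h where "h x = a * (x ^ Suc n - 2 * m / (m + 1) * x ^ Suc (Suc n) + m / (m + 2) * x ^ Suc (Suc (Suc n)))" for x :: real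
  have dh: "(h has_field_derivative a * m * x ^ n * (1 - x)\<^sup>2) (at x)" for x
  proof -
    have "(h has_field_derivative a * (m * x ^ n - 2 * m / (m + 1) * ((m + 1) * x ^ Suc n) +
        m / (m + 2) * ((m + 2) * x ^ Suc (Suc n)))) (at x)"
      proof -
      have pow: "((\<lambda>x. x ^ Suc k) has_field_derivative real (Suc k) * x ^ k) (at x)" for k
        using DERIV_pow[of "Suc k" x UNIV] by simp
      have "(h has_field_derivative a * (real (Suc n) * x ^ n - 2 * m / (m + 1) * (real (Suc (Suc n)) * x ^ Suc n) +
        m / (m + 2) * (real (Suc (Suc (Suc n))) * x ^ Suc (Suc n)))) (at x)"
        unfolding h_def[abs_def] by (intro DERIV_cmult DERIV_add DERIV_diff pow)
      moreover have "real (Suc (Suc n)) = m + 1" "real (Suc (Suc (Suc n))) = m + 2" by (simp_all add: m_def)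
      ultimately show ?thesis by (simp only: m_def)
    qed
    also have "a * (m * x ^ n - 2 * m / (m + 1) * ((m + 1) * x ^ Suc n) +
        m / (m + 2) * ((m + 2) * x ^ Suc (Suc n))) = a * m * x ^ n * (1 - x)\<^sup>2"
    proof -
      have "2 * m / (m + 1) * ((m + 1) * X) = 2 * m * X" "m / (m + 2) * ((m + 2) * X) = m * X" for X
        using m by simp_all
      then show ?thesis by (simp only:) (simp add: power2_eq_square algebra_simps)
    qed
    finally show ?thesis .
  qed
  have "(\<integral>\<^sup>+t. ennreal (real (Suc n) * a * (1 - exp (- t)) ^ n * exp (- 3 * t)) * indicator {0..} t \<partial>lborel) =
      ennreal (h 1 - h (1 - exp (- 0)))"
  proof (rule nn_integral_FTC_atLeast)
    fix t :: real assume "0 \<le> t"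
    show "0 \<le> real (Suc n) * a * (1 - exp (- t)) ^ n * exp (- 3 * t)"
      using assms \<open>0 \<le> t\<close> by auto
    have "((\<lambda>t. h (1 - exp (- t))) has_field_derivative
        a * m * (1 - exp (- t)) ^ n * (1 - (1 - exp (- t)))\<^sup>2 * exp (- t)) (at t)"
      by (rule DERIV_chain2[OF dh]) (auto intro!: derivative_eq_intros)
    also have "a * m * (1 - exp (- t)) ^ n * (1 - (1 - exp (- t)))\<^sup>2 * exp (- t) =
        real (Suc n) * a * (1 - exp (- t)) ^ n * exp (- 3 * t)"
    proof -
      have "(1 - (1 - exp (- t)))\<^sup>2 * exp (- t) = exp (- 3 * t)"
        by (simp add: power2_eq_square flip: exp_add)
      then show ?thesis by (simp add: m_def mult_ac)
    qed
    finally show "((\<lambda>t. h (1 - exp (- t))) has_field_derivative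
        real (Suc n) * a * (1 - exp (- t)) ^ n * exp (- 3 * t)) (at t)" .
  next
    have "((\<lambda>t :: real. 1 - exp (- t)) \<longlongrightarrow> 1) at_top" by real_asymp
    then show "((\<lambda>t. h (1 - exp (- t))) \<longlongrightarrow> h 1) at_top"
      by (rule isCont_tendsto_compose[OF DERIV_isCont[OF dh]])
  qed auto
  also have "h 1 - h (1 - exp (- 0)) = 2 * a / ((m + 1) * (m + 2))"
    using m by (simp add: h_def divide_simps) (simp add: algebra_simps)
  finally show ?thesis by (simp add: m_def)
qed

text \<open>The integrand is a series of nonnegative terms, so integrating termwise in the extended
  reals is legitimate and returns the terms of \<open>unprotected_density\<close>.\<close>

lemma p_star_eq: "p_star (Suc l) = 1 - unprotected_density (Suc l)"
proof -
  let ?a = "shallow_prob (Suc l)"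
  let ?f = "\<lambda>n t. real (Suc n) * ?a (Suc n) * (1 - exp (- t)) ^ n * exp (- 3 * t)"
  let ?g = "\<lambda>t. if t \<in> {0..} then q_fun (Suc l) t * exp (- t) else 0"
  have sums: "(\<lambda>n. ?f n t) sums (q_fun (Suc l) t * exp (- t))" if "t \<ge> 0" for t
  proof -
    have e: "exp (- 3 * t) = exp (- 2 * t) * exp (- t)" by (simp flip: exp_add)
    have "(\<lambda>n. diffs ?a n * (1 - exp (- t)) ^ n) sums (\<Sum>n. diffs ?a n * (1 - exp (- t)) ^ n)"
      by (rule summable_sums[OF sums_summable[OF diffs_shallow_gf_sums]]) (use that in auto)
    from sums_mult2[OF this, of "exp (- 2 * t) * exp (- t)"] show ?thesis
      unfolding q_fun_eq_gf[OF that] e diffs_def by (simp only: mult_ac)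
  qed
  have nonneg: "0 \<le> ?f n t" if "t \<ge> 0" for n t
    using shallow_prob_bounds[of "Suc l" "Suc n"] that by auto
  have g: "ennreal (?g t) = (\<Sum>n. ennreal (?f n t) * indicator {0..} t)" for t
  proof (cases "t \<ge> 0")
    case True
    then have "(\<Sum>n. ennreal (?f n t)) = ennreal (q_fun (Suc l) t * exp (- t))"
      using sums nonneg by (intro suminf_ennreal_eq) auto
    with True show ?thesis by simp
  qed simp
  \<comment> \<open>Measurability of the integrand is read off this series, not off the recursion
    for \<open>q_fun\<close>.\<close>
  have g': "?g = (\<lambda>t. \<Sum>n. ?f n t * indicator {0..} t)"
    using sums_unique[OF sums] by (auto simp: fun_eq_iff indicator_def simp del: of_nat_Suc)
  \<comment> \<open>The term of index 0 vanishes because the empty tree is not shallow; the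
    derivative shifts the index by one.\<close>
  have split: "unprotected_density (Suc l) = (\<Sum>n. 2 * ?a (Suc n) / ((real (Suc n) + 1) * (real (Suc n) + 2)))"
    unfolding unprotected_density_def using suminf_split_head[OF density_summable[of "Suc l"]] by simp
  have "(\<integral>\<^sup>+t. ennreal (?g t) \<partial>lborel) = (\<Sum>n. \<integral>\<^sup>+t. ennreal (?f n t) * indicator {0..} t \<partial>lborel)"
    unfolding g by (rule nn_integral_suminf) auto
  also have "\<dots> = (\<Sum>n. ennreal (2 * ?a (Suc n) / ((real (Suc n) + 1) * (real (Suc n) + 2))))"
    by (intro suminf_cong nn_integral_density_term shallow_prob_bounds)
  also have "\<dots> = ennreal (unprotected_density (Suc l))"
    unfolding split
    by (rule suminf_ennreal2[OF density_term_bounds(1) summable_Suc_iff[THEN iffD2, OF density_summable]])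
  finally have nn: "(\<integral>\<^sup>+t. ennreal (?g t) \<partial>lborel) = ennreal (unprotected_density (Suc l))" .
  have meas: "?g \<in> borel_measurable borel" unfolding g' by measurable
  have "0 \<le> ?g t" for t
    using sums_le[OF nonneg sums_zero sums] by auto
  from nn_integral_has_integral[OF meas this nn unprotected_density_bounds(1)]
  have "((\<lambda>t. q_fun (Suc l) t * exp (- t)) has_integral unprotected_density (Suc l)) {0..}"
    by (simp only: has_integral_restrict_UNIV)
  then show ?thesis by (simp add: p_star_def integral_unique)
qed

text \<open>At level 1 only the single node is shallow, so the generating function is
  \<open>x\<close> and \<open>q_fun 2\<close> is a polynomial in \<open>exp (- t)\<close>. The
  integral is \<open>1 - 2/3 + 1/2 - 1/5 = 19/30\<close>.\<close>

lemma p_star_2: "p_star 2 = 11 / 30"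
proof -
  have r: "r_fun (Suc 0) t = exp (- t) * (1 - exp (- t))" if "t \<ge> 0" for t
  proof -
    have "shallow_prob (Suc 0) n = (if n = 1 then 1 else 0)" for n
      by (cases n) (auto simp: shallow_prob_Suc)
    then have "shallow_prob (Suc 0) n * x ^ n = (if n = 1 then x ^ n else 0)" for n x
      by simp
    then have "shallow_gf (Suc 0) x = x" for x
      using sums_single[of 1 "\<lambda>n. x ^ n"] unfolding shallow_gf_def by (simp only: sums_iff power_one_right)
    then show ?thesis using r_fun_eq[OF that q_fun_eq_gf] by simp
  qed
  have q: "q_fun 2 t * exp (- t) = 2 * exp (- 2 * t) - 2 * exp (- 3 * t) + 2 * exp (- 4 * t) - exp (- 5 * t)"
    if "t \<ge> 0" for t
  proof -
    define y where "y = exp (- t)"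
    have pow: "exp (- 2 * t) = y ^ 2" "exp (- 3 * t) = y ^ 3" "exp (- 4 * t) = y ^ 4" "exp (- 5 * t) = y ^ 5"
      by (simp_all add: y_def flip: exp_of_nat_mult)
    have "q_fun 2 t = y ^ 2 + 2 * (y * (1 - y)) - (y * (1 - y)) ^ 2"
      using r[OF that] pow(1) by (simp add: q_fun.simps numeral_2_eq_2 y_def)
    then show ?thesis
      unfolding pow y_def[symmetric] by (simp only:) (simp add: algebra_simps eval_nat_numeral)
  qed
  have e: "((\<lambda>t. exp (- a * t)) has_integral 1 / a) {0..}" if "a > 0" for a :: real
    using has_integral_exp_minus_to_infinity[OF that, of 0] by simp
  have "((\<lambda>t. 2 * exp (- 2 * t) - 2 * exp (- 3 * t) + 2 * exp (- 4 * t) - exp (- 5 * t)) has_integral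
      2 * (1 / 2) - 2 * (1 / 3) + 2 * (1 / 4) - 1 / 5) {0 :: real..}"
    by (intro has_integral_add has_integral_diff has_integral_mult_right e) simp_all
  then have "((\<lambda>t. q_fun 2 t * exp (- t)) has_integral 19 / 30) {0..}"
    by (subst has_integral_cong[OF q]) simp_all
  then show ?thesis by (simp add: p_star_def integral_unique)
qed

section \<open>From independent uniform keys to the law of the shape\<close>

definition shape :: "'a tree \<Rightarrow> unit tree" where
  "shape t = map_tree (\<lambda>_. ()) t"

lemma shape_simps [simp]:
  "shape Leaf = Leaf" "shape (Node L a R) = Node (shape L) () (shape R)"
  by (simp_all add: shape_def)

section \<open>Insertion of keys in random order\<close>

lemma bst_of_Nil [simp]: "bst_of [] = Leaf"
  by (simp add: bst_of_def)

text \<open>The first key stays at the root and routes each later key to one side, preserving the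
  order of arrival within each side.\<close>

lemma bst_of_Cons:
  "bst_of (x # xs) = Node (bst_of (filter (\<lambda>y. y < x) xs)) x (bst_of (filter (\<lambda>y. \<not> y < x) xs))"
proof -
  have "fold bst_insert xs (Node L x R) =
    Node (fold bst_insert (filter (\<lambda>y. y < x) xs) L) x (fold bst_insert (filter (\<lambda>y. \<not> y < x) xs) R)" for L R
    by (induction xs arbitrary: L R) auto
  then show ?thesis by (simp add: bst_of_def)
qed

text \<open>Makes the rank of a uniformly chosen root, which is the size of the left subtree,
  uniform.\<close>

lemma bij_betw_rank:
  fixes A :: "real set"
  assumes "finite A"
  shows "bij_betw (\<lambda>x. card {y \<in> A. y < x}) A {..<card A}"
proof -
  have inj: "inj_on (\<lambda>x. card {y \<in> A. y < x}) A"
  proof (rule linorder_inj_onI)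
    fix x y assume "x < y" "x \<in> A" "y \<in> A"
    then have "card {z \<in> A. z < x} < card {z \<in> A. z < y}"
      using assms by (intro psubset_card_mono) auto
    then show "card {z \<in> A. z < x} \<noteq> card {z \<in> A. z < y}" by simp
  qed auto
  moreover have "(\<lambda>x. card {y \<in> A. y < x}) ` A \<subseteq> {..<card A}"
  proof (intro image_subsetI)
    fix x assume "x \<in> A"
    then have "card {y \<in> A. y < x} < card A"
      using assms by (intro psubset_card_mono) auto
    then show "card {y \<in> A. y < x} \<in> {..<card A}" by simp
  qed
  ultimately show ?thesis
    by (simp add: bij_betw_def card_image card_subset_eq)
qed

text \<open>The head of a random permutation is uniform and the rest is a random permutation of the
  other keys. Partitioning it at the head gives two independent random permutations, to which
  induction on the number of keys applies.\<close>

lemma shape_random_permutation: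
  fixes A :: "real set"
  assumes "finite A"
  shows "map_pmf (\<lambda>xs. shape (bst_of xs)) (pmf_of_set (permutations_of_set A)) = bst_shape (card A)"
  using assms
proof (induction "card A" arbitrary: A rule: less_induct)
  case less
  show ?case
  proof (cases "A = {}")
    case True
    then show ?thesis by (simp add: pmf_of_set_singleton)
  next
    case False
    let ?perm = "\<lambda>B :: real set. pmf_of_set (permutations_of_set B)"
    let ?sh = "\<lambda>xs. shape (bst_of xs)"
    obtain n where n: "card A = Suc n" using False less.prems by (metis card_0_eq not0_implies_Suc)
    have split: "map_pmf (\<lambda>xs. ?sh (x # xs)) (?perm (A - {x})) =
       do {L \<leftarrow> bst_shape (card {y \<in> A. y < x}); R \<leftarrow> bst_shape (n - card {y \<in> A. y < x}); return_pmf (Node L () R)}"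
      if x: "x \<in> A" for x
    proof -
      let ?l = "{y \<in> A - {x}. y < x}" and ?r = "{y \<in> A - {x}. \<not> y < x}"
      have l: "?l = {y \<in> A. y < x}" by auto
      have lr: "card ?l + card ?r = n"
      proof -
        have "card ?l + card ?r = card (?l \<union> ?r)"
          using less.prems by (subst card_Un_disjoint) auto
        also have "?l \<union> ?r = A - {x}" by auto
        finally show ?thesis using x n less.prems by simp
      qed
      have "map_pmf (\<lambda>xs. ?sh (x # xs)) (?perm (A - {x})) =
         map_pmf (\<lambda>(xs, ys). Node (?sh xs) () (?sh ys)) (map_pmf (partition (\<lambda>y. y < x)) (?perm (A - {x})))"
        by (simp add: map_pmf_comp bst_of_Cons o_def)
      also have "map_pmf (partition (\<lambda>y. y < x)) (?perm (A - {x})) = pair_pmf (?perm ?l) (?perm ?r)"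
        using less.prems by (intro partition_random_permutations) auto
      also have "map_pmf (\<lambda>(xs, ys). Node (?sh xs) () (?sh ys)) (pair_pmf (?perm ?l) (?perm ?r)) =
         do {L \<leftarrow> map_pmf ?sh (?perm ?l); R \<leftarrow> map_pmf ?sh (?perm ?r); return_pmf (Node L () R)}"
        by (simp add: pair_pmf_def map_bind_pmf bind_map_pmf)
      also have "map_pmf ?sh (?perm ?l) = bst_shape (card ?l)"
        using lr n less.prems by (intro less.hyps) auto
      also have "map_pmf ?sh (?perm ?r) = bst_shape (card ?r)"
        using lr n less.prems by (intro less.hyps) auto
      also have "card ?r = n - card ?l" using lr by linarith
      finally show ?thesis by (simp only: l)
    qed
    have "map_pmf ?sh (?perm A) = do {x \<leftarrow> pmf_of_set A; map_pmf (\<lambda>xs. ?sh (x # xs)) (?perm (A - {x}))}"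
      using less.prems False
      by (subst random_permutation_of_set) (auto simp: map_bind_pmf map_pmf_def bind_assoc_pmf bind_return_pmf)
    also have "\<dots> = do {x \<leftarrow> pmf_of_set A;
       L \<leftarrow> bst_shape (card {y \<in> A. y < x}); R \<leftarrow> bst_shape (n - card {y \<in> A. y < x}); return_pmf (Node L () R)}"
      using less.prems False by (intro bind_pmf_cong refl split) simp
    also have "\<dots> = do {k \<leftarrow> map_pmf (\<lambda>x. card {y \<in> A. y < x}) (pmf_of_set A);
       L \<leftarrow> bst_shape k; R \<leftarrow> bst_shape (n - k); return_pmf (Node L () R)}"
      by (simp add: bind_map_pmf)
    also have "map_pmf (\<lambda>x. card {y \<in> A. y < x}) (pmf_of_set A) = pmf_of_set {..<card A}"
      using less.prems False bij_betw_rank[of A] by (intro map_pmf_of_set_bij_betw) auto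
    also have "{..<card A} = {..n}" by (auto simp: n)
    finally show ?thesis by (simp add: n bst_shape.simps(2))
  qed
qed

lemma bij_betw_permutations_list:
  assumes "inj_on x {..<n}"
  shows "bij_betw (\<lambda>\<sigma>. map (\<lambda>i. x (\<sigma> i)) [0..<n]) {\<sigma>. \<sigma> permutes {..<n}} (permutations_of_set (x ` {..<n}))"
proof -
  let ?f = "\<lambda>\<sigma>. map (\<lambda>i. x (\<sigma> i)) [0..<n]"
  have inj: "inj_on ?f {\<sigma>. \<sigma> permutes {..<n}}"
  proof (rule inj_onI, rule ext)
    fix \<sigma> \<tau> i assume *: "\<sigma> \<in> {\<sigma>. \<sigma> permutes {..<n}}" "\<tau> \<in> {\<sigma>. \<sigma> permutes {..<n}}" "?f \<sigma> = ?f \<tau>"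
    show "\<sigma> i = \<tau> i"
    proof (cases "i < n")
      case True
      then have "x (\<sigma> i) = x (\<tau> i)" using *(3) by auto
      moreover have "\<sigma> i < n" "\<tau> i < n" using * True permutes_in_image[of _ "{..<n}" i] by auto
      ultimately show ?thesis using assms by (auto dest: inj_onD)
    next
      case False
      then show ?thesis using * by (simp add: permutes_not_in)
    qed
  qed
  have "?f \<sigma> \<in> permutations_of_set (x ` {..<n})" if "\<sigma> permutes {..<n}" for \<sigma>
  proof (rule permutations_of_setI)
    have "set (?f \<sigma>) = x ` (\<sigma> ` {..<n})" by (auto simp: image_image atLeast0LessThan)
    then show "set (?f \<sigma>) = x ` {..<n}" using that by (simp add: permutes_image)
    have "inj_on (x \<circ> \<sigma>) {..<n}"
      using that assms by (intro comp_inj_on) (simp_all add: permutes_inj_on permutes_image)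
    then show "distinct (?f \<sigma>)" by (simp add: distinct_map o_def atLeast0LessThan)
  qed
  then have sub: "?f ` {\<sigma>. \<sigma> permutes {..<n}} \<subseteq> permutations_of_set (x ` {..<n})" by auto
  \<comment> \<open>Surjectivity by counting: image and target both have \<open>fact n\<close>
    elements.\<close>
  have "card (permutations_of_set (x ` {..<n})) = fact n"
    using assms by (simp add: card_image)
  moreover have "card (?f ` {\<sigma>. \<sigma> permutes {..<n}}) = fact n"
    using inj by (simp add: card_image card_permutations)
  ultimately have "?f ` {\<sigma>. \<sigma> permutes {..<n}} = permutations_of_set (x ` {..<n})"
    using sub by (intro card_subset_eq) auto
  with inj show ?thesis by (simp add: bij_betw_def)
qed

definition keys_shape :: "nat \<Rightarrow> (nat \<Rightarrow> real) \<Rightarrow> unit tree" where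
  "keys_shape n x = shape (bst_of (map x [0..<n]))"

lemma keys_shape_random_permutation:
  assumes "inj_on x {..<n}"
  shows "map_pmf (\<lambda>\<sigma>. keys_shape n (\<lambda>i. x (\<sigma> i))) (pmf_of_set {\<sigma>. \<sigma> permutes {..<n}}) = bst_shape n"
proof -
  have "map_pmf (\<lambda>\<sigma>. keys_shape n (\<lambda>i. x (\<sigma> i))) (pmf_of_set {\<sigma>. \<sigma> permutes {..<n}}) =
    map_pmf (\<lambda>xs. shape (bst_of xs))
      (map_pmf (\<lambda>\<sigma>. map (\<lambda>i. x (\<sigma> i)) [0..<n]) (pmf_of_set {\<sigma>. \<sigma> permutes {..<n}}))"
    by (simp add: map_pmf_comp keys_shape_def)
  also have "map_pmf (\<lambda>\<sigma>. map (\<lambda>i. x (\<sigma> i)) [0..<n]) (pmf_of_set {\<sigma>. \<sigma> permutes {..<n}}) =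
      pmf_of_set (permutations_of_set (x ` {..<n}))"
    using bij_betw_permutations_list[OF assms] permutes_id[of "{..<n}"]
    by (intro map_pmf_of_set_bij_betw) (auto simp: finite_permutations simp del: permutes_id)
  also have "map_pmf (\<lambda>xs. shape (bst_of xs)) \<dots> = bst_shape (card (x ` {..<n}))"
    by (rule shape_random_permutation) simp
  also have "card (x ` {..<n}) = n" using assms by (simp add: card_image)
  finally show ?thesis .
qed

text \<open>The shape depends on the keys only through their finitely many pairwise comparisons.\<close>

function compare_shape :: "(nat \<times> nat) set \<Rightarrow> nat list \<Rightarrow> unit tree" where
  "compare_shape r [] = Leaf"
| "compare_shape r (i # is) =
     Node (compare_shape r (filter (\<lambda>j. (j, i) \<in> r) is)) () (compare_shape r (filter (\<lambda>j. (j, i) \<notin> r) is))"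
  by pat_completeness auto
termination
  by (relation "Wellfounded.measure (\<lambda>(r, is). length is)") (auto simp: le_imp_less_Suc)

lemma shape_eq_compare_shape:
  assumes "set is \<subseteq> I"
  shows "shape (bst_of (map x is)) = compare_shape {(i, j) \<in> I \<times> I. x i < x j} is"
  using assms
proof (induction "{(i, j) \<in> I \<times> I. x i < x j}" "is" rule: compare_shape.induct)
  case (2 i "is")
  have eq: "filter (\<lambda>j. (j, i) \<in> {(i, j) \<in> I \<times> I. x i < x j}) is = filter (\<lambda>j. x j < x i) is"
    "filter (\<lambda>j. (j, i) \<notin> {(i, j) \<in> I \<times> I. x i < x j}) is = filter (\<lambda>j. \<not> x j < x i) is"
    using 2(3) by (auto intro!: filter_cong)
  have sub: "set (filter (\<lambda>j. x j < x i) is) \<subseteq> I" "set (filter (\<lambda>j. \<not> x j < x i) is) \<subseteq> I"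
    using 2(3) by auto
  show ?case
    using 2(1)[unfolded eq, OF sub(1)] 2(2)[unfolded eq, OF sub(2)]
    by (simp only: list.map bst_of_Cons shape_simps compare_shape.simps eq filter_map o_def)
qed simp

text \<open>The comparison relation takes finitely many values, each cut out by finitely many
  comparisons of measurable keys, and the shape is a function of that relation.\<close>

lemma measurable_keys_shape:
  assumes [measurable]: "\<And>i. i < n \<Longrightarrow> (\<lambda>w. X i w) \<in> borel_measurable M"
  shows "(\<lambda>w. keys_shape n (\<lambda>i. X i w)) \<in> M \<rightarrow>\<^sub>M count_space UNIV"
proof -
  let ?I = "{..<n}"
  let ?R = "\<lambda>w. {(i, j) \<in> ?I \<times> ?I. X i w < X j w}"
  have "?R \<in> M \<rightarrow>\<^sub>M count_space (Pow (?I \<times> ?I))"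
  proof (rule measurable_count_space_eq2[THEN iffD2, rule_format], goal_cases)
    case 2
    show ?case
    proof (intro conjI ballI)
      fix r assume "r \<in> Pow (?I \<times> ?I)"
      then have "?R -` {r} \<inter> space M = {w \<in> space M. \<forall>i\<in>?I. \<forall>j\<in>?I. (i, j) \<in> r \<longleftrightarrow> X i w < X j w}"
        by auto
      also have "\<dots> \<in> sets M" by measurable
      finally show "?R -` {r} \<inter> space M \<in> sets M" .
    qed auto
  qed simp
  then have "(\<lambda>w. compare_shape (?R w) [0..<n]) \<in> M \<rightarrow>\<^sub>M count_space UNIV"
    by (rule measurable_compose) simp
  then show ?thesis
    unfolding keys_shape_def using shape_eq_compare_shape[of "[0..<n]" ?I] by (simp add: atLeast0LessThan)
qed

text \<open>The joint law of two keys is a product of atomless measures, so the diagonal is null;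
  only finitely many pairs occur.\<close>

lemma AE_inj_on_if_iid_uniform:
  assumes "iid_uniform M n X"
  shows "AE w in M. inj_on (\<lambda>i. X i w) {..<n}"
proof -
  interpret prob_space M using assms by (simp add: iid_uniform_def)
  have ind: "indep_vars (\<lambda>_. borel) X {..<n}"
    and distr: "\<And>i. i < n \<Longrightarrow> distr M borel (X i) = uniform_measure lborel {0..1}"
    using assms by (auto simp: iid_uniform_def)
  let ?U = "uniform_measure lborel {0..1::real}"
  interpret U: prob_space ?U by (rule prob_space_uniform_measure) auto
  have neq: "AE w in M. X i w \<noteq> X j w" if ij: "i < n" "j < n" "i \<noteq> j" for i j
  proof -
    \<comment> \<open>Pairwise independence is obtained by restricting the family to two disjoint
      singletons and then projecting.\<close>
    have "indep_var (PiM {i} (\<lambda>_. borel)) (\<lambda>w. restrict (\<lambda>i. X i w) {i})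
                    (PiM {j} (\<lambda>_. borel)) (\<lambda>w. restrict (\<lambda>i. X i w) {j})"
      using ij by (intro indep_var_restrict[OF ind]) auto
    then have "indep_var borel ((\<lambda>x. x i) \<circ> (\<lambda>w. restrict (\<lambda>i. X i w) {i}))
                    borel ((\<lambda>x. x j) \<circ> (\<lambda>w. restrict (\<lambda>i. X i w) {j}))"
      by (rule indep_var_compose) auto
    then have ij_indep: "indep_var borel (X i) borel (X j)" by (simp add: o_def)
    then have [measurable]: "X i \<in> borel_measurable M" "X j \<in> borel_measurable M"
      by (auto simp: indep_var_distribution_eq)
    have pair: "distr M (borel \<Otimes>\<^sub>M borel) (\<lambda>w. (X i w, X j w)) = ?U \<Otimes>\<^sub>M ?U"
      using ij_indep ij by (simp add: indep_var_distribution_eq distr)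
    have D: "{(x, y). x = y} \<in> sets (borel \<Otimes>\<^sub>M borel :: (real \<times> real) measure)"
    proof -
      have "{p \<in> space (borel \<Otimes>\<^sub>M borel). fst p = snd p} \<in> sets (borel \<Otimes>\<^sub>M borel :: (real \<times> real) measure)"
        by measurable
      also have "{p \<in> space (borel \<Otimes>\<^sub>M borel). fst p = snd p} = {(x :: real, y). x = y}"
        by (auto simp: space_pair_measure)
      finally show ?thesis .
    qed
    have "emeasure M {w \<in> space M. X i w = X j w} =
        emeasure (distr M (borel \<Otimes>\<^sub>M borel) (\<lambda>w. (X i w, X j w))) {(x, y). x = y}"
      by (subst emeasure_distr) (auto intro!: arg_cong[where f = "emeasure M"] D)
    also have "\<dots> = (\<integral>\<^sup>+ x. emeasure ?U (Pair x -` {(x, y). x = y}) \<partial>?U)"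
      unfolding pair using D
      by (subst U.emeasure_pair_measure_alt) (simp_all cong: sets_pair_measure_cong)
    also have "\<dots> = (\<integral>\<^sup>+ x. 0 \<partial>?U)"
    proof (rule nn_integral_cong)
      fix x :: real
      have "Pair x -` {(x, y). x = y} = {x}" by auto
      then show "emeasure ?U (Pair x -` {(x, y). x = y}) = 0"
        using emeasure_mono[of "{0..1} \<inter> {x}" "{x}" lborel] by (simp add: emeasure_uniform_measure)
    qed
    finally have "emeasure M {w \<in> space M. X i w = X j w} = 0" by simp
    then show ?thesis by (subst AE_iff_measurable[OF _ refl]) auto
  qed
  have "AE w in M. \<forall>p\<in>{(i, j) \<in> {..<n} \<times> {..<n}. i \<noteq> j}. X (fst p) w \<noteq> X (snd p) w"
    by (rule AE_finite_allI) (auto intro: finite_subset[of _ "{..<n} \<times> {..<n}"] neq)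
  then show ?thesis by eventually_elim (force simp: inj_on_def)
qed

text \<open>Exchangeability: a product of identical factors is invariant under permuting
  coordinates.\<close>

lemma distr_permuted_keys:
  assumes "iid_uniform M n X" "0 < n" "\<sigma> permutes {..<n}"
  shows "distr M (PiM {..<n} (\<lambda>_. borel)) (\<lambda>w. \<lambda>i\<in>{..<n}. X (\<sigma> i) w) =
         PiM {..<n} (\<lambda>_. uniform_measure lborel {0..1})"
proof -
  interpret prob_space M using assms by (simp add: iid_uniform_def)
  let ?U = "uniform_measure lborel {0..1::real}" and ?I = "{..<n}"
  let ?B = "PiM ?I (\<lambda>_. borel :: real measure)" and ?P = "PiM ?I (\<lambda>_. ?U)"
  let ?perm = "\<lambda>x. \<lambda>i\<in>?I. x (\<sigma> i) :: real"
  have ind: "indep_vars (\<lambda>_. borel) X ?I"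
    and distr: "\<And>i. i < n \<Longrightarrow> distr M borel (X i) = ?U"
    using assms by (auto simp: iid_uniform_def)
  have rv: "X i \<in> borel_measurable M" if "i \<in> ?I" for i
    using ind that unfolding indep_vars_def by blast
  have sets: "sets ?P = sets ?B" by (rule sets_PiM_cong) simp_all
  have bij: "\<sigma> i \<in> ?I" if "i \<in> ?I" for i
    using that permutes_in_image[OF assms(3), of i] by simp
  have "distr M ?B (\<lambda>w. \<lambda>i\<in>?I. X i w) = PiM ?I (\<lambda>i. distr M borel (X i))"
    by (rule indep_vars_iff_distr_eq_PiM'[THEN iffD1, OF _ rv ind]) (use assms(2) in auto)
  also have "\<dots> = ?P" by (rule PiM_cong) (simp_all add: distr)
  finally have Y: "distr M ?B (\<lambda>w. \<lambda>i\<in>?I. X i w) = ?P" .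
  have "distr M ?B (\<lambda>w. ?perm (\<lambda>i\<in>?I. X i w)) = distr (distr M ?B (\<lambda>w. \<lambda>i\<in>?I. X i w)) ?B ?perm"
    using rv bij by (subst distr_distr) (auto simp: o_def intro!: measurable_restrict)
  also have "\<dots> = distr ?P ?P ?perm"
    unfolding Y by (rule distr_cong) (simp_all add: sets)
  also have "\<dots> = ?P"
    using distr_PiM_reindex[of ?I "\<lambda>_. ?U" \<sigma> ?I] bij assms(3)
    by (simp add: permutes_inj_on prob_space_uniform_measure)
  also have "(\<lambda>w. ?perm (\<lambda>i\<in>?I. X i w)) = (\<lambda>w. \<lambda>i\<in>?I. X (\<sigma> i) w)"
    using bij by (auto simp: fun_eq_iff)
  finally show ?thesis .
qed

lemma keys_shape_cong: "(\<And>i. i < n \<Longrightarrow> x i = y i) \<Longrightarrow> keys_shape n x = keys_shape n y"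
  unfolding keys_shape_def by (intro arg_cong[where f = "\<lambda>xs. shape (bst_of xs)"] map_cong) auto

text \<open>Symmetrization: for almost every outcome, averaging over all relabellings of the keys
  yields \<open>bst_shape n\<close>, and by exchangeability each relabelling has the same law as the
  original.\<close>

lemma distr_keys_shape:
  assumes iid: "iid_uniform M n X"
  shows "distr M (count_space UNIV) (\<lambda>w. keys_shape n (\<lambda>i. X i w)) = measure_pmf (bst_shape n)"
\<comment> \<open>The empty family is treated apart, since \<open>distr_permuted_keys\<close>
  requires \<open>0 < n\<close>.\<close>
proof (cases "n = 0")
  case True
  interpret prob_space M using iid by (simp add: iid_uniform_def)
  show ?thesis using True by (simp add: keys_shape_def return_pmf.rep_eq)
next
  case False
  interpret prob_space M using iid by (simp add: iid_uniform_def)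
  let ?I = "{..<n}" and ?S = "{\<sigma>. \<sigma> permutes {..<n}}"
  let ?P = "PiM ?I (\<lambda>_. uniform_measure lborel {0..1::real})"
  let ?B = "PiM ?I (\<lambda>_. borel :: real measure)"
  let ?K = "\<lambda>\<sigma> w. keys_shape n (\<lambda>i. X (\<sigma> i) w)"
  have rv: "X i \<in> borel_measurable M" if "i < n" for i
    using iid that by (auto simp: iid_uniform_def indep_vars_def)
  have K: "?K \<sigma> \<in> M \<rightarrow>\<^sub>M count_space UNIV" if "\<sigma> permutes ?I" for \<sigma>
    using permutes_in_image[OF that] by (intro measurable_keys_shape rv) auto
  have key: "keys_shape n \<in> ?B \<rightarrow>\<^sub>M count_space UNIV"
    by (rule measurable_keys_shape[where X = "\<lambda>i x. x i"]) auto
  \<comment> \<open>The right-hand side does not mention \<sigma>, so all permuted shapes are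
    equally distributed.\<close>
  have law: "prob (?K \<sigma> -` A \<inter> space M) = measure ?P (keys_shape n -` A \<inter> space ?B)"
    if \<sigma>: "\<sigma> permutes ?I" for \<sigma> A
  proof -
    have rs: "(\<lambda>w. \<lambda>i\<in>?I. X (\<sigma> i) w) \<in> M \<rightarrow>\<^sub>M ?B"
      using permutes_in_image[OF \<sigma>] rv by (auto intro!: measurable_restrict)
    have "measure ?P (keys_shape n -` A \<inter> space ?B) =
       measure (distr M ?B (\<lambda>w. \<lambda>i\<in>?I. X (\<sigma> i) w)) (keys_shape n -` A \<inter> space ?B)"
      using distr_permuted_keys[OF iid _ \<sigma>] False by simp
    also have "\<dots> = prob ((\<lambda>w. \<lambda>i\<in>?I. X (\<sigma> i) w) -` (keys_shape n -` A \<inter> space ?B) \<inter> space M)"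
      by (rule measure_distr[OF rs]) (use key in \<open>auto intro: measurable_sets\<close>)
    also have "(\<lambda>w. \<lambda>i\<in>?I. X (\<sigma> i) w) -` (keys_shape n -` A \<inter> space ?B) \<inter> space M = ?K \<sigma> -` A \<inter> space M"
    proof -
      have "keys_shape n (\<lambda>i\<in>?I. X (\<sigma> i) w) = ?K \<sigma> w" for w by (rule keys_shape_cong) auto
      then show ?thesis using measurable_space[OF rs] by auto
    qed
    finally show ?thesis by simp
  qed
  have S: "finite ?S" "?S \<noteq> {}" "card ?S = fact n"
    using permutes_id[of ?I] by (auto simp: finite_permutations card_permutations simp del: permutes_id)
  show ?thesis
  proof (rule measure_eqI)
    fix A :: "unit tree set"
    have "measure_pmf.prob (bst_shape n) A = (\<integral>w. measure_pmf.prob (bst_shape n) A \<partial>M)"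
      by (simp add: prob_space)
    \<comment> \<open>For a fixed outcome with distinct keys the constant probability is an average
      of indicators over all permutations; integrating then moves the randomness back to
      \<open>M\<close>.\<close>
    also have "\<dots> = (\<integral>w. (\<Sum>\<sigma>\<in>?S. indicator (?K \<sigma> -` A \<inter> space M) w / fact n) \<partial>M)"
    proof (rule integral_cong_AE)
      show "AE w in M. measure_pmf.prob (bst_shape n) A = (\<Sum>\<sigma>\<in>?S. indicator (?K \<sigma> -` A \<inter> space M) w / fact n)"
        using AE_inj_on_if_iid_uniform[OF iid] AE_space
      proof eventually_elim
        case (elim w)
        have "measure_pmf.prob (bst_shape n) A = measure_pmf.prob (pmf_of_set ?S) ((\<lambda>\<sigma>. ?K \<sigma> w) -` A)"
          using keys_shape_random_permutation[OF elim(1)] by (metis measure_map_pmf)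
        also have "\<dots> = (\<Sum>\<sigma>\<in>?S. indicator ((\<lambda>\<sigma>. ?K \<sigma> w) -` A) \<sigma>) / fact n"
          using S(1,3) by (subst measure_pmf_of_set[OF S(2,1)]) (simp add: indicator_def sum.If_cases Int_def)
        also have "\<dots> = (\<Sum>\<sigma>\<in>?S. indicator (?K \<sigma> -` A \<inter> space M) w / fact n)"
          unfolding sum_divide_distrib using elim(2) by (intro sum.cong) (auto simp: indicator_def)
        finally show ?case .
      qed
      show "(\<lambda>w. \<Sum>\<sigma>\<in>?S. indicator (?K \<sigma> -` A \<inter> space M) w / fact n :: real) \<in> borel_measurable M"
        using K by (auto intro!: borel_measurable_sum borel_measurable_divide borel_measurable_indicator intro: measurable_sets)
    qed simp
    also have "\<dots> = (\<Sum>\<sigma>\<in>?S. prob (?K \<sigma> -` A \<inter> space M) / fact n)"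
    proof (subst Bochner_Integration.integral_sum)
      fix \<sigma> assume "\<sigma> \<in> ?S"
      then have "?K \<sigma> -` A \<inter> space M \<in> events" using K by (auto intro: measurable_sets)
      then show "integrable M (\<lambda>w. indicator (?K \<sigma> -` A \<inter> space M) w / fact n :: real)"
        by (auto intro!: integrable_real_indicator simp: emeasure_eq_measure)
    qed auto
    also have "\<dots> = prob (?K id -` A \<inter> space M)"
      using S(3) law[OF permutes_id, of A] by (simp add: law)
    finally have "prob (?K id -` A \<inter> space M) = measure_pmf.prob (bst_shape n) A" by simp
    then show "emeasure (distr M (count_space UNIV) (\<lambda>w. keys_shape n (\<lambda>i. X i w))) A =
        emeasure (measure_pmf (bst_shape n)) A"
      using K[of id] by (subst emeasure_distr) (auto simp: emeasure_eq_measure measure_pmf.emeasure_eq_measure permutes_id)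
  qed simp
qed

section \<open>The theorem\<close>

text \<open>Protection depends on addresses only. Passing to shapes replaces real-labelled trees by
  a discrete space, where every function is measurable.\<close>

lemma random_bst_via_keys_shape:
  "nodes (random_bst n X w) = nodes (keys_shape n (\<lambda>i. X i w))"
  "is_protected l (random_bst n X w) = is_protected l (keys_shape n (\<lambda>i. X i w))"
  "protected_proportion l (random_bst n X w) = protected_proportion l (keys_shape n (\<lambda>i. X i w))"
  by (simp_all add: keys_shape_def shape_def random_bst_def is_protected_map_tree[abs_def])

lemma measurable_keys_shape_iid:
  assumes "iid_uniform M n X"
  shows "(\<lambda>w. keys_shape n (\<lambda>i. X i w)) \<in> M \<rightarrow>\<^sub>M count_space UNIV"
proof (rule measurable_keys_shape)
  interpret prob_space M using assms by (simp add: iid_uniform_def)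
  show "X i \<in> borel_measurable M" if "i < n" for i
    using assms that by (auto simp: iid_uniform_def indep_vars_def)
qed

lemma integral_random_bst:
  assumes "iid_uniform M n X"
  shows "(\<integral>w. protected_proportion l (random_bst n X w) \<partial>M) = expect n (protected_proportion l)"
proof -
  have "(\<integral>w. protected_proportion l (random_bst n X w) \<partial>M) =
      (\<integral>w. protected_proportion l (keys_shape n (\<lambda>i. X i w)) \<partial>M)"
    by (simp only: random_bst_via_keys_shape)
  also have "\<dots> = (\<integral>t. protected_proportion l t \<partial>distr M (count_space UNIV) (\<lambda>w. keys_shape n (\<lambda>i. X i w)))"
    by (rule integral_distr[OF measurable_keys_shape_iid[OF assms], symmetric]) simp
  finally show ?thesis by (simp add: distr_keys_shape[OF assms])
qed

lemma measure_random_bst: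
  assumes "iid_uniform M n X"
  shows "measure M {w \<in> space M. P (protected_proportion l (random_bst n X w))} =
     measure_pmf.prob (bst_shape n) {t. P (protected_proportion l t)}"
proof -
  have "measure_pmf.prob (bst_shape n) {t. P (protected_proportion l t)} =
     measure (distr M (count_space UNIV) (\<lambda>w. keys_shape n (\<lambda>i. X i w))) {t. P (protected_proportion l t)}"
    by (simp add: distr_keys_shape[OF assms])
  also have "\<dots> = measure M ((\<lambda>w. keys_shape n (\<lambda>i. X i w)) -` {t. P (protected_proportion l t)} \<inter> space M)"
    by (rule measure_distr[OF measurable_keys_shape_iid[OF assms]]) simp
  also have "(\<lambda>w. keys_shape n (\<lambda>i. X i w)) -` {t. P (protected_proportion l t)} \<inter> space M =
     {w \<in> space M. P (protected_proportion l (random_bst n X w))}"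
    by (auto simp only: random_bst_via_keys_shape)
  finally show ?thesis ..
qed

lemma measure_random_node_protected:
  assumes "t \<noteq> Leaf"
  shows "measure_pmf.prob (map_pmf (is_protected l t) (pmf_of_set (nodes t))) {True} = protected_proportion l t"
proof -
  have "measure_pmf.prob (map_pmf (is_protected l t) (pmf_of_set (nodes t))) {True} =
      real (card (nodes t \<inter> is_protected l t -` {True})) / real (card (nodes t))"
    unfolding measure_map_pmf by (rule measure_pmf_of_set) (use assms in auto)
  also have "nodes t \<inter> is_protected l t -` {True} = {v. is_protected l t v}"
    using is_protected_def[of l t] by blast
  finally show ?thesis by (simp only: protected_proportion_def)
qed

lemma random_bst_not_Leaf:
  assumes "n \<ge> 1"
  shows "random_bst n X w \<noteq> Leaf"
proof -
  have "map (\<lambda>i. X i w) [0..<n] \<noteq> []" using assms by simp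
  then obtain x xs where "map (\<lambda>i. X i w) [0..<n] = x # xs" by (meson neq_Nil_conv)
  then show ?thesis by (simp only: random_bst_def bst_of_Cons) simp
qed

text \<open>The kernel choosing a node factors through the discrete shape and is therefore
  measurable, so the joint probability is the mean of the conditional ones. For
  \<open>n >= 1\<close> the tree is nonempty and a uniform node exists.\<close>

lemma random_node_protected_prob_random_bst:
  assumes iid: "iid_uniform M n X" and "n \<ge> 1"
  shows "random_node_protected_prob M (random_bst n X) l =
    (\<integral>w. protected_proportion l (random_bst n X w) \<partial>M)"
proof -
  interpret prob_space M using iid by (simp add: iid_uniform_def)
  let ?K = "\<lambda>t. measure_pmf (map_pmf (is_protected l t) (pmf_of_set (nodes t)))"
  have "?K (random_bst n X w) = ?K (keys_shape n (\<lambda>i. X i w))" for w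
    by (simp only: random_bst_via_keys_shape)
  moreover have "(\<lambda>w. ?K (keys_shape n (\<lambda>i. X i w))) \<in> M \<rightarrow>\<^sub>M subprob_algebra (count_space UNIV)"
    by (rule measurable_compose[OF measurable_keys_shape_iid[OF iid] measurable_measure_pmf])
  ultimately have "(\<lambda>w. ?K (random_bst n X w)) \<in> M \<rightarrow>\<^sub>M subprob_algebra (count_space UNIV)"
    by simp
  then have "random_node_protected_prob M (random_bst n X) l =
      (\<integral>w. measure (?K (random_bst n X w)) {True} \<partial>M)"
    unfolding random_node_protected_prob_def by (rule measure_bind) simp
  then show ?thesis
    by (simp only: measure_random_node_protected[OF random_bst_not_Leaf[OF assms(2)]])
qed

theorem mainTheorem3:
  fixes M :: "nat \<Rightarrow> 'w measure" and X :: "nat \<Rightarrow> nat \<Rightarrow> 'w \<Rightarrow> real"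
  assumes "\<And>n. iid_uniform (M n) n (X n)"
  shows
    "(\<forall>l\<ge>1.
        (\<forall>n\<ge>1. random_node_protected_prob (M n) (random_bst n (X n)) l
              = (\<integral>w. protected_proportion l (random_bst n (X n) w) \<partial>M n)) \<and>
        (\<lambda>n. \<integral>w. protected_proportion l (random_bst n (X n) w) \<partial>M n) \<longlonglongrightarrow> p_star l \<and>
        tendsto_in_prob M (\<lambda>n w. protected_proportion l (random_bst n (X n) w)) (p_star l)) \<and>
     p_star 2 = 11 / 30"
proof (intro conjI allI impI)
  fix l :: nat assume "l \<ge> 1"
  then have p: "p_star l = 1 - unprotected_density l" by (cases l) (simp_all add: p_star_eq)
  show "random_node_protected_prob (M n) (random_bst n (X n)) l
              = (\<integral>w. protected_proportion l (random_bst n (X n) w) \<partial>M n)" if "n \<ge> 1" for n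
    using assms that by (rule random_node_protected_prob_random_bst)
  show "(\<lambda>n. \<integral>w. protected_proportion l (random_bst n (X n) w) \<partial>M n) \<longlonglongrightarrow> p_star l"
    unfolding p integral_random_bst[OF assms] by (rule expect_protected_proportion_tendsto)
  show "tendsto_in_prob M (\<lambda>n w. protected_proportion l (random_bst n (X n) w)) (p_star l)"
    unfolding tendsto_in_prob_def p
  proof (intro allI impI)
    fix \<epsilon> :: real assume "\<epsilon> > 0"
    have "measure (M n) {w \<in> space (M n). \<epsilon> < \<bar>protected_proportion l (random_bst n (X n) w) - (1 - unprotected_density l)\<bar>} =
       measure_pmf.prob (bst_shape n) {t. \<epsilon> < \<bar>protected_proportion l t - (1 - unprotected_density l)\<bar>}" for n
      by (rule measure_random_bst[OF assms, where P = "\<lambda>p. \<epsilon> < \<bar>p - (1 - unprotected_density l)\<bar>"])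
    with prob_deviation_tendsto_0[OF \<open>\<epsilon> > 0\<close>, of l]
    show "(\<lambda>n. measure (M n) {w \<in> space (M n). \<epsilon> < \<bar>protected_proportion l (random_bst n (X n) w) - (1 - unprotected_density l)\<bar>}) \<longlonglongrightarrow> 0"
      by simp
  qed
qed (rule p_star_2)

end
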